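(* Let $V \subset \mathbb{Z}_5^3$ be a nonempty set. Then $V$ tiles $\mathbb{Z}_5^3$ by translation if and only if $V$ is spectral.
   Context: $\mathbb{Z}_5 = \mathbb{Z}/5\mathbb{Z}$, and $\mathbb{Z}_5^3$ is the corresponding three-dimensional vector space over the field with 5 elements. A set $V \subset \mathbb{Z}_5^3$ tiles (by translation) if there exists a set $A \subset \mathbb{Z}_5^3$ such that every element of $\mathbb{Z}_5^3$ can be written in exactly one way as $v + a$ with $v \in V$, $a \in A$. A set $V \subset \mathbb{Z}_5^3$ is spectral if $L^2(V)$, the space of functions $V \to \mathbb{C}$ with inner product $\langle f, g\rangle = \sum_{x \in V} f(x)\overline{g(x)}$, has an orthogonal basis of exponentials; that is, there exists a set $B \subset \mathbb{Z}_5^3$ such that the functions $x \mapsto e^{2\pi i (x\cdot b)/5}$, $b \in B$, restricted to $V$, form an orthogonal basis of $L^2(V)$ (distinct $b \in B$ giving distinct basis elements, so $|B| = |V|$). Here $x \cdot b = x_1b_1 + x_2b_2 + x_3b_3$. *)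

theory Defs
  imports "HOL-Analysis.Analysis" "HOL-Library.Function_Algebras"
begin

text \<open>
  The numeral type \<^typ>\<open>5\<close> is the ring of integers modulo 5, so \<^typ>\<open>5 ^ 3\<close> is
  the three-dimensional space over the field with five elements, with componentwise addition.
\<close>

definition tiles :: "(5 ^ 3) set \<Rightarrow> bool" where
  "tiles V \<longleftrightarrow> (\<exists>A. \<forall>x. \<exists>!p. p \<in> V \<times> A \<and> x = fst p + snd p)"

text \<open>\<^term>\<open>Rep_bit1\<close> is the representative in \<open>{0..<5}\<close>.\<close>

definition chi :: "5 ^ 3 \<Rightarrow> 5 ^ 3 \<Rightarrow> complex" where
  "chi b x = exp (2 * of_real pi * \<i> * of_int (Rep_bit1 (scalar_product x b)) / 5)"

interpretation cfun: vector_space "\<lambda>(c :: complex) (f :: 'a \<Rightarrow> complex) x. c * f x"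
  by unfold_locales (auto simp: fun_eq_iff algebra_simps)

text \<open>
  A function on \<open>V\<close> is encoded as a function on the whole type that vanishes outside \<open>V\<close>;
  accordingly \<open>restr\<close> is restriction to \<open>V\<close> followed by extension by zero.
\<close>

definition L2 :: "'a set \<Rightarrow> ('a \<Rightarrow> complex) set" where
  "L2 V = {f. \<forall>x. x \<notin> V \<longrightarrow> f x = 0}"

definition restr :: "'a set \<Rightarrow> ('a \<Rightarrow> complex) \<Rightarrow> 'a \<Rightarrow> complex" where
  "restr V f = (\<lambda>x. if x \<in> V then f x else 0)"

definition inner_L2 :: "'a set \<Rightarrow> ('a \<Rightarrow> complex) \<Rightarrow> ('a \<Rightarrow> complex) \<Rightarrow> complex" where
  "inner_L2 V f g = (\<Sum>x\<in>V. f x * cnj (g x))"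

definition orthogonal_basis :: "'a set \<Rightarrow> ('a \<Rightarrow> complex) set \<Rightarrow> bool" where
  "orthogonal_basis V E \<longleftrightarrow>
     cfun.independent E \<and> cfun.span E = L2 V \<and>
     pairwise (\<lambda>f g. inner_L2 V f g = 0) E"

definition spectral :: "(5 ^ 3) set \<Rightarrow> bool" where
  "spectral V \<longleftrightarrow>
     (\<exists>B. inj_on (\<lambda>b. restr V (chi b)) B \<and> orthogonal_basis V ((\<lambda>b. restr V (chi b)) ` B))"

end

theory Submission
  imports Defs
begin

text \<open>
  Write \<open>n = card V\<close>. An exponential sum over \<open>V\<close> vanishes at \<open>d \<noteq> 0\<close> iff \<open>V\<close> is equidistributed over the
  five planes orthogonal to \<open>d\<close>, because the primitive fifth roots of unity satisfy only the trivial
  integer relation. So a spectrum is a set \<open>B\<close> of size \<open>n\<close> such that \<open>V\<close> is equidistributed in every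
  direction \<open>b - b'\<close>; then conversely \<open>B\<close> is equidistributed in every direction \<open>v - v'\<close>.

  If \<open>V\<close> tiles with \<open>A\<close>, then \<open>n\<close> divides 125; for \<open>n = 5\<close> a line is a spectrum, and for \<open>n = 25\<close> the plane
  \<open>(a - a')\<^sup>\<bottom>\<close> is one for any \<open>a \<noteq> a'\<close> in \<open>A\<close>, as \<open>A\<close> is not equidistributed in any of its directions.

  If \<open>V\<close> is spectral and \<open>n \<noteq> 1\<close>, then \<open>n = 5 k\<close>. For \<open>k = 1\<close> a plane is a tiling complement, for \<open>k = 5\<close> a line
  in a direction missed by \<open>V - V\<close> is one, and \<open>k > 5\<close> forces all directions to occur, hence \<open>n = 125\<close>.
  The point is to exclude \<open>k = 2, 3, 4\<close>. Projecting along \<open>d\<close> shows that the uneven directions of \<open>V\<close>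
  orthogonal to \<open>d\<close> are never exactly zero or two in number, that all planes contain at most five points
  of \<open>V\<close>, and that a unique uneven direction \<open>x\<close> means that \<open>V\<close> has \<open>0\<close> or \<open>5\<close> points on each plane
  orthogonal to \<open>x\<close>. Four coplanar, not collinear points of \<open>V\<close> determine four directions, which
  makes the uneven direction of \<open>B\<close> in their plane unique.
  For \<open>k = 3, 4\<close> this applies to every uneven direction, and counting incidences between uneven
  directions and their orthogonal planes is contradictory. For \<open>k = 2\<close> it yields orthogonal \<open>\<eta>, \<xi>\<close> such that \<open>V\<close>
  and \<open>B\<close> consist of two graphs over parallel lines each; then the graphs making up \<open>B\<close> determine so few
  directions that they are lines, which is impossible.
\<close>

subsection \<open>Geometry over the field with five elements\<close>

lemma F5_cases: "(x :: 5) = 0 \<or> x = 1 \<or> x = 2 \<or> x = 3 \<or> x = 4"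
proof (cases x rule: bit1_cases)
  case (of_int z)
  then have "z = 0 \<or> z = 1 \<or> z = 2 \<or> z = 3 \<or> z = 4" by auto
  then show ?thesis using of_int by auto
qed

lemma UNIV_F5: "(UNIV :: 5 set) = {0, 1, 2, 3, 4}"
  using F5_cases by blast

lemma all_F5: "(\<forall>x :: 5. P x) \<longleftrightarrow> P 0 \<and> P 1 \<and> P 2 \<and> P 3 \<and> P 4"
proof (rule iffI)
  show "\<forall>x. P x" if "P 0 \<and> P 1 \<and> P 2 \<and> P 3 \<and> P 4"
  proof
    fix x show "P x" using F5_cases[of x] that by (elim disjE) simp_all
  qed
qed blast

lemma sum_F5: "(\<Sum>x\<in>(UNIV :: 5 set). f x) = f 0 + f 1 + f 2 + f 3 + (f 4 :: 'a :: comm_monoid_add)"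
  unfolding UNIV_F5 by (simp add: ac_simps)

text \<open>Fermat gives \<open>x ^ 4 = 1\<close>, so the cube serves as the inverse of a nonzero
  scalar throughout.\<close>

lemma inverse_F5: "x \<noteq> 0 \<Longrightarrow> x * x ^ 3 = (1 :: 5)"
  using F5_cases[of x] by (elim disjE) simp_all

lemma F5_mult_eq_0: "x * y = 0 \<Longrightarrow> (x :: 5) = 0 \<or> y = 0"
  using F5_cases[of x] F5_cases[of y] by (elim disjE) simp_all

lemma F5_cancel:
  assumes "c * x = c * y" "(c :: 5) \<noteq> 0" shows "x = y"
proof -
  have "c * (x - y) = 0" using assms(1) by (simp add: right_diff_distrib)
  then show ?thesis using F5_mult_eq_0[of c "x - y"] assms(2) by simp
qed

text \<open>Nonzero vectors can be orthogonal to themselves, for example (1, 2, 0), so the arguments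
  go by counting and cross products instead of orthogonal decompositions.\<close>

abbreviation dot :: "5 ^ 3 \<Rightarrow> 5 ^ 3 \<Rightarrow> 5"  (infixl \<open>\<odot>\<close> 70) where
  "x \<odot> y \<equiv> scalar_product x y"

lemma dot_eq: "x \<odot> y = x $ 1 * y $ 1 + x $ 2 * y $ 2 + x $ 3 * y $ 3"
  by (simp add: scalar_product_def sum_3)

lemma vec3_eq_iff: "(x :: 5 ^ 3) = y \<longleftrightarrow> x $ 1 = y $ 1 \<and> x $ 2 = y $ 2 \<and> x $ 3 = y $ 3"
  by (simp add: vec_eq_iff forall_3)

lemma dot_simps [simp]:
  "0 \<odot> y = 0" "x \<odot> 0 = 0"
  "(x + y) \<odot> z = x \<odot> z + y \<odot> z" "z \<odot> (x + y) = z \<odot> x + z \<odot> y"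
  "(x - y) \<odot> z = x \<odot> z - y \<odot> z" "z \<odot> (x - y) = z \<odot> x - z \<odot> y"
  "(c *s x) \<odot> y = c * (x \<odot> y)" "x \<odot> (c *s y) = c * (x \<odot> y)"
  by (simp_all add: dot_eq algebra_simps)

lemma dot_commute: "x \<odot> y = y \<odot> x"
  by (simp add: dot_eq mult.commute)

lemma smult_eq_0_iff: "c *s x = 0 \<longleftrightarrow> c = 0 \<or> (x :: 5 ^ 3) = 0"
  by (auto simp: vec3_eq_iff dest: F5_mult_eq_0)

lemma smult_cancel: "c *s x = c' *s x \<Longrightarrow> (x :: 5 ^ 3) \<noteq> 0 \<Longrightarrow> c = c'"
  by (metis smult_eq_0_iff right_minus_eq vector_sub_rdistrib)

section \<open>Cross products as a test for linear independence\<close>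

definition cross :: "5 ^ 3 \<Rightarrow> 5 ^ 3 \<Rightarrow> 5 ^ 3" where
  "cross x y = vector [x $ 2 * y $ 3 - x $ 3 * y $ 2, x $ 3 * y $ 1 - x $ 1 * y $ 3,
                       x $ 1 * y $ 2 - x $ 2 * y $ 1]"

lemma cross_component [simp]:
  "cross x y $ 1 = x $ 2 * y $ 3 - x $ 3 * y $ 2"
  "cross x y $ 2 = x $ 3 * y $ 1 - x $ 1 * y $ 3"
  "cross x y $ 3 = x $ 1 * y $ 2 - x $ 2 * y $ 1"
  by (simp_all add: cross_def)

lemma cross_smult: "cross x (c *s x) = 0" "cross (c *s x) x = 0" "cross 0 x = 0" "cross x 0 = 0"
  by (simp_all add: vec3_eq_iff algebra_simps)

lemma cross_parallel: "cross (c *s x) (c' *s x) = 0"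
  by (simp add: vec3_eq_iff algebra_simps)

lemma dot_cross: "cross x y \<odot> x = 0" "cross x y \<odot> y = 0"
  by (simp_all add: dot_eq algebra_simps)

lemma cross_lincomb: "cross (a *s u + b *s w) w = a *s cross u w"
  "cross u (a *s u + b *s w) = b *s cross u w"
  "cross (a *s u + b *s w) (a' *s u + b' *s w) = (a * b' - a' * b) *s cross u w"
  by (simp_all add: vec3_eq_iff algebra_simps)

lemma cross_commute: "cross x y = 0 \<longleftrightarrow> cross y x = 0"
  by (auto simp: vec3_eq_iff algebra_simps)

lemma parallel_if_cross_0:
  assumes "cross u w = 0" "u \<noteq> 0"
  obtains c where "w = c *s u"
proof -
  have e: "u $ 2 * w $ 3 = u $ 3 * w $ 2" "u $ 3 * w $ 1 = u $ 1 * w $ 3" "u $ 1 * w $ 2 = u $ 2 * w $ 1"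
    using assms(1) by (auto simp: vec3_eq_iff)
  \<comment> \<open>At a nonzero coordinate of \<open>u\<close> the factor must be the quotient
    \<open>w $ i / u $ i\<close>.\<close>
  have *: "\<exists>c. w = c *s u" if i: "u $ i \<noteq> 0" and "\<And>j. u $ i * w $ j = u $ j * w $ i" for i
  proof
    have "w $ j = (w $ i * (u $ i) ^ 3) * u $ j" for j
    proof -
      have "w $ j = (u $ i * (u $ i) ^ 3) * w $ j" using inverse_F5[OF i] by simp
      also have "\<dots> = (u $ i * w $ j) * (u $ i) ^ 3" by (simp only: ac_simps)
      also have "\<dots> = (u $ j * w $ i) * (u $ i) ^ 3" by (simp only: that(2)[of j])
      also have "\<dots> = (w $ i * (u $ i) ^ 3) * u $ j" by (simp only: ac_simps)
      finally show ?thesis .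
    qed
    then show "w = (w $ i * (u $ i) ^ 3) *s u" unfolding vec_eq_iff vector_smult_component by blast
  qed
  have "\<forall>j. u $ 1 * w $ j = u $ j * w $ 1" "\<forall>j. u $ 2 * w $ j = u $ j * w $ 2"
    "\<forall>j. u $ 3 * w $ j = u $ j * w $ 3"
    using e by (auto simp: forall_3 mult.commute)
  moreover have "u $ 1 \<noteq> 0 \<or> u $ 2 \<noteq> 0 \<or> u $ 3 \<noteq> 0" using assms(2) by (auto simp: vec3_eq_iff)
  ultimately show ?thesis using * that by blast
qed

lemma cross_ne_0_iff: "u \<noteq> 0 \<Longrightarrow> cross u w \<noteq> 0 \<longleftrightarrow> w \<notin> range (\<lambda>c. c *s u)"
  by (metis cross_smult(1) parallel_if_cross_0 rangeE rangeI)

lemma cross_ne_0D: "cross u w \<noteq> 0 \<Longrightarrow> u \<noteq> 0" "cross u w \<noteq> 0 \<Longrightarrow> w \<noteq> 0"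
  by (auto simp: cross_smult)

lemma orthogonal_both:
  assumes "x \<odot> u = 0" "x \<odot> w = 0" "cross u w \<noteq> 0"
  obtains c where "x = c *s cross u w"
proof -
  \<comment> \<open>By this triple product expansion, a vector orthogonal to \<open>u\<close> and
    \<open>w\<close> is parallel to their cross product.\<close>
  have "cross (cross u w) x = (x \<odot> u) *s w - (x \<odot> w) *s u"
    by (simp add: vec3_eq_iff dot_eq algebra_simps)
  then show ?thesis using assms parallel_if_cross_0 that by auto
qed

lemma exists_dot_1:
  assumes "d \<noteq> 0" obtains e where "e \<odot> d = 1"
proof -
  obtain i where i: "d $ i \<noteq> 0" using assms by (auto simp: vec_eq_iff)
  have "axis i (d $ i ^ 3) \<odot> d = 1"
    by (simp add: scalar_product_def axis_def if_distrib[of "\<lambda>x. x * _"] inverse_F5[OF i]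
      mult.commute[of "_ ^ 3"] cong: if_cong)
  then show ?thesis by (rule that)
qed

lemma card_plane:
  assumes "d \<noteq> 0" shows "card {x. x \<odot> d = t} = 25"
proof -
  obtain e where e: "e \<odot> d = 1" using assms exists_dot_1 by blast
  \<comment> \<open>Translation by \<open>s *s e\<close> matches level 0 with level
    \<open>s\<close>, so the 125 points are shared equally by five planes.\<close>
  have c: "card {x. x \<odot> d = s} = card {x. x \<odot> d = 0}" for s
    by (rule bij_betw_same_card[of "\<lambda>x. x - s *s e"], rule bij_betw_byWitness[where f' = "\<lambda>x. x + s *s e"])
      (auto simp: e)
  have "card (UNIV :: (5 ^ 3) set) = card (\<Union>s. {x. x \<odot> d = s})"
    by (rule arg_cong[of _ _ card]) auto
  also have "\<dots> = (\<Sum>s\<in>UNIV. card {x. x \<odot> d = s})"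
    by (rule card_UN_disjoint) auto
  also have "\<dots> = (\<Sum>s\<in>(UNIV :: 5 set). card {x. x \<odot> d = 0})" by (intro sum.cong refl c)
  also have "\<dots> = 5 * card {x. x \<odot> d = 0}" by simp
  finally show ?thesis using c[of t] by simp
qed

lemma card_line: "u \<noteq> 0 \<Longrightarrow> card (range (\<lambda>c. c *s (u :: 5 ^ 3))) = 5"
  using card_image[of "\<lambda>c. c *s u" UNIV] smult_cancel by (auto simp: inj_on_def)

lemma orthogonal_both_eq:
  assumes "cross u w \<noteq> 0"
  shows "{x. x \<odot> u = 0 \<and> x \<odot> w = 0} = range (\<lambda>c. c *s cross u w)"
proof
  show "{x. x \<odot> u = 0 \<and> x \<odot> w = 0} \<subseteq> range (\<lambda>c. c *s cross u w)"
    by clarify (metis assms orthogonal_both rangeI)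
qed (auto simp: dot_cross)

lemma orthogonal_basis_exists:
  assumes "d \<noteq> 0" "u \<noteq> 0" "u \<odot> d = 0"
  obtains w where "w \<odot> d = 0" "cross u w \<noteq> 0"
proof -
  have "\<not> {x. x \<odot> d = 0} \<subseteq> range (\<lambda>c. c *s u)"
    using card_plane[OF assms(1), of 0] card_line[OF assms(2)]
      card_mono[of "range (\<lambda>c. c *s u)" "{x. x \<odot> d = 0}"] by auto
  then show ?thesis using that cross_ne_0_iff[OF assms(2)] by auto
qed

lemma exists_orthogonal:
  assumes "d \<noteq> 0" obtains u where "u \<noteq> 0" "u \<odot> d = 0"
proof -
  have "\<not> {x. x \<odot> d = 0} \<subseteq> {0}"
    using card_mono[of "{0}" "{x. x \<odot> d = 0}"] card_plane[OF assms, of 0] by auto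
  then show ?thesis using that by auto
qed

lemma lincomb_eq:
  assumes "cross u w \<noteq> 0" "a *s u + b *s w = a' *s u + b' *s w"
  shows "a = a'" "b = b'"
proof -
  from assms(2) have "a *s cross u w = a' *s cross u w" "b *s cross u w = b' *s cross u w"
    by (metis cross_lincomb(1), metis cross_lincomb(2))
  then show "a = a'" "b = b'" using smult_cancel assms(1) by blast+
qed

text \<open>The 25 combinations of \<open>u\<close> and \<open>w\<close> are distinct, hence fill
  the plane, which has 25 points.\<close>

lemma in_plane_span:
  assumes "cross u w \<noteq> 0" "d \<noteq> 0" "u \<odot> d = 0" "w \<odot> d = 0" "x \<odot> d = 0"
  obtains a b where "x = a *s u + b *s w"
proof -
  let ?f = "\<lambda>(a, b). a *s u + b *s w"
  have "inj ?f" using lincomb_eq[OF assms(1)] by (auto simp: inj_on_def)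
  then have "card (range ?f) = 25" using card_image[of ?f UNIV] by (simp flip: UNIV_Times_UNIV)
  then have "range ?f = {x. x \<odot> d = 0}"
    using assms card_plane[of d 0] by (intro card_subset_eq) auto
  then have "x \<in> range ?f" using assms(5) by auto
  then show ?thesis using that by auto
qed

section \<open>Points of the projective plane, represented by vectors with first nonzero coordinate
  1\<close>

definition proj :: "(5 ^ 3) set" where
  "proj = {x. x $ 1 = 1 \<or> x $ 1 = 0 \<and> x $ 2 = 1 \<or> x $ 1 = 0 \<and> x $ 2 = 0 \<and> x $ 3 = 1}"

lemma zero_notin_proj [simp]: "0 \<notin> proj"
  by (simp add: proj_def)

lemma proj_exists:
  assumes "x \<noteq> 0" obtains c r where "c \<noteq> 0" "r \<in> proj" "x = c *s r" "r = c ^ 3 *s x"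
proof -
  define c where "c = (if x $ 1 \<noteq> 0 then x $ 1 else if x $ 2 \<noteq> 0 then x $ 2 else x $ 3)"
  have c: "c \<noteq> 0" using assms by (auto simp: c_def vec3_eq_iff)
  have 1: "c ^ 3 *s x \<in> proj"
    using c by (auto simp: proj_def c_def inverse_F5 mult.commute[of "_ ^ 3"] split: if_splits)
  have 2: "c *s (c ^ 3 *s x) = x" using inverse_F5[OF c] by (simp only: vector_smult_assoc vector_smult_lid)
  show ?thesis using that[OF c 1 2[symmetric]] by simp
qed

lemma proj_unique:
  assumes "r \<in> proj" "r' \<in> proj" "r' = c *s r" shows "c = 1" "r' = r"
proof -
  show "c = 1" using assms by (auto simp: proj_def)
  then show "r' = r" using assms by simp
qed

lemma proj_cross: "r \<in> proj \<Longrightarrow> r' \<in> proj \<Longrightarrow> r \<noteq> r' \<Longrightarrow> cross r r' \<noteq> 0"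
  by (metis parallel_if_cross_0 proj_unique(2) zero_notin_proj)

text \<open>Each orbit of the four nonzero scalars contains exactly one normalised
  representative.\<close>

lemma card_scaling_closed:
  assumes "0 \<notin> X" "\<And>x c. x \<in> X \<Longrightarrow> c \<noteq> 0 \<Longrightarrow> c *s x \<in> X"
  shows "card X = 4 * card (X \<inter> proj)"
proof -
  have "bij_betw (\<lambda>(c, r). c *s r) ((UNIV - {0}) \<times> (X \<inter> proj)) X"
    unfolding bij_betw_def
  proof
    show "inj_on (\<lambda>(c, r). c *s r) ((UNIV - {0}) \<times> (X \<inter> proj))"
    proof (rule inj_onI, unfold mem_Times_iff)
      fix p q :: "5 \<times> (5 ^ 3)"
      assume p: "fst p \<in> UNIV - {0} \<and> snd p \<in> X \<inter> proj"
        and q: "fst q \<in> UNIV - {0} \<and> snd q \<in> X \<inter> proj"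
        and pq: "(\<lambda>(c, r). c *s r) p = (\<lambda>(c, r). c *s r) q"
      obtain c r c' r' where [simp]: "p = (c, r)" "q = (c', r')" by fastforce
      have "c \<noteq> 0" "c' \<noteq> 0" "r \<in> X" "r \<in> proj" "r' \<in> proj" and e: "c *s r = c' *s r'"
        using p q pq by auto
      have "r' = (c' ^ 3 * c) *s r" using arg_cong[OF e, of "\<lambda>x. c' ^ 3 *s x"] inverse_F5[OF \<open>c' \<noteq> 0\<close>]
        by (simp add: vector_smult_assoc mult.commute)
      then have "r = r'" using proj_unique(2)[OF \<open>r \<in> proj\<close> \<open>r' \<in> proj\<close>] by metis
      moreover have "r \<noteq> 0" using \<open>r \<in> X\<close> assms(1) by auto
      ultimately show "p = q" using e smult_cancel[of c r c'] by simp
    qed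
    show "(\<lambda>(c, r). c *s r) ` ((UNIV - {0}) \<times> (X \<inter> proj)) = X"
    proof
      show "X \<subseteq> (\<lambda>(c, r). c *s r) ` ((UNIV - {0}) \<times> (X \<inter> proj))"
      proof
        fix x assume x: "x \<in> X"
        then obtain c r where cr: "c \<noteq> 0" "r \<in> proj" "x = c *s r" "r = c ^ 3 *s x"
          using assms(1) proj_exists by metis
        have "c ^ 3 \<noteq> 0" using inverse_F5[OF cr(1)] by auto
        then have "r \<in> X" using assms(2)[OF x] cr(4) by metis
        then show "x \<in> (\<lambda>(c, r). c *s r) ` ((UNIV - {0}) \<times> (X \<inter> proj))"
          using cr(1-3) by (intro image_eqI[of _ _ "(c, r)"]) auto
      qed
    qed (use assms in auto)
  qed
  then have "card X = card ((UNIV - {0 :: 5}) \<times> (X \<inter> proj))" by (simp add: bij_betw_same_card)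
  then show ?thesis by (simp add: card_cartesian_product)
qed

lemma card_proj: "card proj = 31"
proof -
  have "card (- {0 :: 5 ^ 3}) = 4 * card (- {0} \<inter> proj)"
    by (rule card_scaling_closed) (auto simp: smult_eq_0_iff)
  moreover have "- {0} \<inter> proj = proj" by auto
  moreover have "card (- {0 :: 5 ^ 3}) = 124" by (simp add: Compl_eq_Diff_UNIV card_Diff_subset)
  ultimately show ?thesis by simp
qed

lemma card_proj_plane:
  assumes "d \<noteq> 0" shows "card {x \<in> proj. x \<odot> d = 0} = 6"
proof -
  have "card ({x. x \<odot> d = 0} - {0}) = 4 * card (({x. x \<odot> d = 0} - {0}) \<inter> proj)"
    by (rule card_scaling_closed) (auto simp: smult_eq_0_iff)
  moreover have "({x. x \<odot> d = 0} - {0}) \<inter> proj = {x \<in> proj. x \<odot> d = 0}" by auto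
  ultimately show ?thesis using card_plane[OF assms, of 0] by simp
qed

text \<open>Two distinct projective lines meet in one point: the common orthogonal space has four
  nonzero vectors, all parallel.\<close>

lemma card_proj_both:
  assumes "cross u w \<noteq> 0" shows "card {x \<in> proj. x \<odot> u = 0 \<and> x \<odot> w = 0} = 1"
proof -
  let ?X = "{x. x \<odot> u = 0 \<and> x \<odot> w = 0}"
  have "card (?X - {0}) = 4 * card ((?X - {0}) \<inter> proj)"
    by (rule card_scaling_closed) (auto simp: smult_eq_0_iff)
  moreover have "(?X - {0}) \<inter> proj = {x \<in> proj. x \<odot> u = 0 \<and> x \<odot> w = 0}" by auto
  moreover have "card ?X = 5" using orthogonal_both_eq[OF assms] card_line[OF assms] by simp
  ultimately show ?thesis by simp
qed

subsection \<open>Plane and line counts\<close>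

definition plane_count :: "(5 ^ 3) set \<Rightarrow> 5 ^ 3 \<Rightarrow> 5 \<Rightarrow> nat" where
  "plane_count V d t = card {v \<in> V. v \<odot> d = t}"

definition line_count :: "(5 ^ 3) set \<Rightarrow> 5 ^ 3 \<Rightarrow> 5 ^ 3 \<Rightarrow> 5 \<Rightarrow> 5 \<Rightarrow> nat" where
  "line_count V u w s t = card {v \<in> V. v \<odot> u = s \<and> v \<odot> w = t}"

text \<open>Written without division, so that the condition itself forces 5 to divide
  \<open>card V\<close>. It amounts to the vanishing of the character sum of \<open>V\<close> at
  \<open>d\<close>, see \<open>sum_chi_eq_0_iff\<close>.\<close>

definition equidist :: "(5 ^ 3) set \<Rightarrow> 5 ^ 3 \<Rightarrow> bool" where
  "equidist V d \<longleftrightarrow> (\<forall>t. 5 * plane_count V d t = card V)"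

lemma card_eq_sum_of_bool: "card {v \<in> V. P v} = (\<Sum>v\<in>V. of_bool (P v))" if "finite V"
  using that by (simp add: sum.If_cases of_bool_def Int_def)

lemma sum_plane_count: "(\<Sum>t\<in>UNIV. plane_count V d t) = card V"
proof -
  have "card V = card (\<Union>t. {v \<in> V. v \<odot> d = t})" by (rule arg_cong[of _ _ card]) auto
  also have "\<dots> = (\<Sum>t\<in>UNIV. plane_count V d t)" unfolding plane_count_def by (rule card_UN_disjoint) auto
  finally show ?thesis by simp
qed

lemma plane_count_scale: "c \<noteq> 0 \<Longrightarrow> plane_count V (c *s d) (c * t) = plane_count V d t"
  unfolding plane_count_def dot_simps by (rule arg_cong[of _ _ card]) (auto dest: F5_cancel)

lemma equidist_scale:
  assumes "c \<noteq> 0" shows "equidist V (c *s d) \<longleftrightarrow> equidist V d"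
proof
  assume e: "equidist V d"
  show "equidist V (c *s d)"
    unfolding equidist_def
  proof
    fix t
    have "plane_count V (c *s d) t = plane_count V d (c ^ 3 * t)"
      using plane_count_scale[OF assms, of V d "c ^ 3 * t"] inverse_F5[OF assms] by (simp flip: mult.assoc)
    then show "5 * plane_count V (c *s d) t = card V" using e by (simp add: equidist_def)
  qed
next
  assume e: "equidist V (c *s d)"
  show "equidist V d"
    unfolding equidist_def
  proof
    fix t
    show "5 * plane_count V d t = card V" using e plane_count_scale[OF assms, of V d t] by (metis equidist_def)
  qed
qed

lemma line_count_commute: "line_count V u w s t = line_count V w u t s"
  unfolding line_count_def by (rule arg_cong[of _ _ card]) auto

text \<open>The six linear forms \<beta> and \<alpha> + c\<beta> all vanish at the origin; at any
  other point exactly one of them does.\<close>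

lemma six_indicator:
  "of_bool (\<beta> = 0) + (\<Sum>c\<in>UNIV. of_bool (\<alpha> + c * \<beta> = 0)) = 5 * of_bool (\<alpha> = 0 \<and> \<beta> = 0) + (1 :: nat)"
  for \<alpha> \<beta> :: 5
  unfolding sum_F5 using F5_cases[of \<alpha>] F5_cases[of \<beta>] by (elim disjE) simp_all

text \<open>The six lines through a point of the affine plane over the field with five elements cover
  that point six times and every other point once.\<close>

lemma six_planes:
  "plane_count V w t + (\<Sum>c\<in>UNIV. plane_count V (u + c *s w) (s + c * t)) = 5 * line_count V u w s t + card V"
proof -
  have e: "v \<odot> (u + c *s w) = s + c * t \<longleftrightarrow> (v \<odot> u - s) + c * (v \<odot> w - t) = 0" for v c
    by (simp add: algebra_simps) 
  have "plane_count V w t + (\<Sum>c\<in>UNIV. plane_count V (u + c *s w) (s + c * t)) =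
    (\<Sum>v\<in>V. of_bool (v \<odot> w - t = 0)) +
      (\<Sum>c\<in>UNIV. \<Sum>v\<in>V. of_bool ((v \<odot> u - s) + c * (v \<odot> w - t) = 0))"
    unfolding plane_count_def by (simp only: card_eq_sum_of_bool finite e right_minus_eq)
  also have "\<dots> = (\<Sum>v\<in>V. of_bool (v \<odot> w - t = 0) +
      (\<Sum>c\<in>UNIV. of_bool ((v \<odot> u - s) + c * (v \<odot> w - t) = 0)))"
    by (subst sum.swap) (simp only: sum.distrib)
  also have "\<dots> = (\<Sum>v\<in>V. 5 * of_bool (v \<odot> u - s = 0 \<and> v \<odot> w - t = 0) + 1)"
    by (simp only: six_indicator)
  also have "\<dots> = 5 * line_count V u w s t + card V"
    unfolding line_count_def card_eq_sum_of_bool[OF finite] right_minus_eq sum.distrib sum_distrib_left[symmetric]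
    by simp
  finally show ?thesis .
qed

text \<open>For nonzero \<open>d\<close> these are, up to scaling, the nonzero frequencies at which
  the projection of \<open>V\<close> along \<open>d\<close> has a nonvanishing Fourier
  coefficient.\<close>

definition uneven_orth :: "(5 ^ 3) set \<Rightarrow> 5 ^ 3 \<Rightarrow> (5 ^ 3) set" where
  "uneven_orth V d = {x \<in> proj. x \<odot> d = 0 \<and> \<not> equidist V x}"

lemma uneven_orth_representative:
  assumes "x \<noteq> 0" "x \<odot> d = 0" "\<not> equidist V x"
  obtains c r where "r \<in> uneven_orth V d" "c \<noteq> 0" "x = c *s r"
proof -
  obtain c r where cr: "c \<noteq> 0" "r \<in> proj" "x = c *s r" "r = c ^ 3 *s x"
    using proj_exists[OF assms(1)] by metis
  have "r \<odot> d = 0" by (subst cr(4)) (simp add: assms(2))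
  moreover have "\<not> equidist V r" using assms(3) cr(1,3) equidist_scale by metis
  ultimately show ?thesis using cr(1-3) that[of r c] by (simp add: uneven_orth_def)
qed

lemma card_uneven_orth_le: "d \<noteq> 0 \<Longrightarrow> card (uneven_orth V d) \<le> 6"
  unfolding card_proj_plane[symmetric] uneven_orth_def by (intro card_mono) auto

subsection \<open>Spectral pairs of size \<open>5 k\<close>\<close>

text \<open>The hypotheses are symmetric in \<open>V\<close> and \<open>B\<close>, so by
  \<open>dual\<close> each result also holds with the two sets exchanged.\<close>

locale spectral_pair =
  fixes V B :: "(5 ^ 3) set" and k :: nat
  assumes k: "0 < k" "k < 5"
    and card_V: "card V = 5 * k" and card_B: "card B = 5 * k"
    and equidist_V: "\<And>b b'. b \<in> B \<Longrightarrow> b' \<in> B \<Longrightarrow> b \<noteq> b' \<Longrightarrow> equidist V (b - b')"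
    and equidist_B: "\<And>v v'. v \<in> V \<Longrightarrow> v' \<in> V \<Longrightarrow> v \<noteq> v' \<Longrightarrow> equidist B (v - v')"
begin

lemma dual: "spectral_pair B V k"
  by unfold_locales (use k card_V card_B equidist_V equidist_B in auto)

lemma equidist_plane_count: "equidist V x \<Longrightarrow> plane_count V x t = k"
  by (auto simp: equidist_def card_V)

text \<open>Otherwise all six planes through a line parallel to \<open>d\<close> contain
  \<open>k\<close> points, and \<open>six_planes\<close> makes \<open>k\<close> five times the
  number of points on the line.\<close>

lemma uneven_orth_nonempty:
  assumes "d \<noteq> 0" shows "uneven_orth V d \<noteq> {}"
proof
  assume e: "uneven_orth V d = {}"
  obtain u where u: "u \<noteq> 0" "u \<odot> d = 0" using exists_orthogonal[OF assms] .
  obtain w where w: "w \<odot> d = 0" "cross u w \<noteq> 0" using orthogonal_basis_exists[OF assms u] .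
  have *: "plane_count V x t = k" if "x \<noteq> 0" "x \<odot> d = 0" for x t
  proof (cases "equidist V x")
    case False
    then show ?thesis using uneven_orth_representative[OF that False] e by blast
  qed (rule equidist_plane_count)
  have "u + c *s w \<noteq> 0" for c
    using cross_lincomb(1)[of 1 u c w] w(2) cross_ne_0D(1)[of "u + c *s w" w] by simp
  then have "(\<Sum>c\<in>(UNIV :: 5 set). plane_count V (u + c *s w) (0 + c * 0)) = (\<Sum>c\<in>(UNIV :: 5 set). k)"
    by (intro sum.cong refl *) (simp_all add: u w)
  moreover have "plane_count V w 0 = k" using w cross_ne_0D(2)[OF w(2)] by (intro *)
  ultimately have "plane_count V w 0 + (\<Sum>c\<in>(UNIV :: 5 set). plane_count V (u + c *s w) (0 + c * 0)) = 6 * k"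
    by simp
  then have "6 * k = 5 * line_count V u w 0 0 + 5 * k" unfolding six_planes card_V by simp
  then show False using k by presburger
qed

text \<open>Let \<open>x\<close> be an uneven direction of \<open>B\<close> orthogonal to
  \<open>d\<close>. Each of the five lines of direction \<open>x\<close> in the plane contains at
  most one point of \<open>V\<close>, since differences of points of \<open>V\<close> are even
  directions of \<open>B\<close>.\<close>

lemma plane_le:
  assumes "d \<noteq> 0" shows "plane_count V d t \<le> 5"
proof (rule ccontr)
  assume *: "\<not> plane_count V d t \<le> 5"
  interpret D: spectral_pair B V k by (rule dual)
  obtain x where "x \<in> uneven_orth B d" using D.uneven_orth_nonempty[OF assms] by auto
  then have x: "x \<noteq> 0" "x \<odot> d = 0" "\<not> equidist B x" unfolding uneven_orth_def by auto
  obtain u where u: "u \<odot> x = 0" "cross d u \<noteq> 0"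
    using orthogonal_basis_exists[OF x(1) assms] x(2) by (metis dot_commute)
  have "\<not> inj_on (\<lambda>v. v \<odot> u) {v \<in> V. v \<odot> d = t}"
  proof
    assume "inj_on (\<lambda>v. v \<odot> u) {v \<in> V. v \<odot> d = t}"
    from card_inj_on_le[OF this, of UNIV] show False using * by (simp add: plane_count_def)
  qed
  then obtain a b where ab: "a \<in> V" "b \<in> V" "a \<noteq> b" "(a - b) \<odot> d = 0" "(a - b) \<odot> u = 0"
    by (auto simp: inj_on_def)
  obtain c where c: "a - b = c *s cross d u" using orthogonal_both[OF ab(4,5) u(2)] .
  obtain c' where c': "x = c' *s cross d u" using orthogonal_both[OF x(2) _ u(2)] u(1) by (metis dot_commute)
  have "c \<noteq> 0" "c' \<noteq> 0" using c c' ab(3) x(1) by auto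
  then have "equidist B x" using equidist_B[OF ab(1-3)] equidist_scale c c' by metis
  then show False using x by simp
qed

text \<open>In \<open>six_planes\<close>, the five further planes through the line have at most 5
  points each.\<close>

lemma line_le:
  assumes "cross u w \<noteq> 0"
  shows "5 * line_count V u w s t + 5 * k \<le> plane_count V u s + 25"
proof -
  have "plane_count V (w + c *s u) (t + c * s) \<le> 5" for c
    using plane_le cross_lincomb(2)[of u c 1 w] assms cross_ne_0D(2)[of u "w + c *s u"]
    by (simp add: add.commute)
  then have "(\<Sum>c\<in>UNIV. plane_count V (w + c *s u) (t + c * s)) \<le> (\<Sum>c\<in>(UNIV :: 5 set). 5)"
    by (intro sum_mono)
  then show ?thesis using six_planes[of V u s w t] by (simp add: line_count_commute card_V)
qed

text \<open>The five further planes through the line have \<open>k\<close> points each and cancel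
  against \<open>card V\<close> in \<open>six_planes\<close>.\<close>

lemma uneven_orth_single:
  assumes "uneven_orth V d = {x}" "w \<odot> d = 0" "cross x w \<noteq> 0"
  shows "plane_count V x s = 5 * line_count V x w s t"
proof -
  have *: "plane_count V y r = k" if y: "y \<odot> d = 0" "cross x y \<noteq> 0" for y r
  proof (cases "equidist V y")
    case False
    obtain c r where "r \<in> uneven_orth V d" "y = c *s r"
      using uneven_orth_representative[OF cross_ne_0D(2)[OF y(2)] y(1) False] by metis
    then show ?thesis using assms(1) y(2) by (simp add: cross_smult)
  qed (rule equidist_plane_count)
  have x: "x \<odot> d = 0" using assms(1) by (auto simp: uneven_orth_def)
  have "cross x (w + c *s x) \<noteq> 0" for c
    using cross_lincomb(2)[of x c 1 w] assms(3) by (simp add: add.commute)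
  then have "(\<Sum>c\<in>UNIV. plane_count V (w + c *s x) (t + c * s)) = (\<Sum>c\<in>(UNIV :: 5 set). k)"
    by (intro sum.cong refl *) (auto simp: x assms)
  then show ?thesis using six_planes[of V x s w t] by (simp add: line_count_commute card_V)
qed

text \<open>Four of the six planes through a line have \<open>k\<close> points, so the counts for
  \<open>x\<close> and \<open>y\<close> add up to \<open>k\<close> modulo 5 at all levels. Hence
  each count is constant modulo 5; unevenness makes both residues 0, and then 5 divides
  \<open>k\<close>.\<close>

lemma card_uneven_orth_ne_2:
  assumes "d \<noteq> 0" shows "card (uneven_orth V d) \<noteq> 2"
proof
  assume "card (uneven_orth V d) = 2"
  then obtain x y where xy: "uneven_orth V d = {x, y}" "x \<noteq> y" by (auto simp: card_2_iff)
  have m: "x \<in> proj" "x \<odot> d = 0" "\<not> equidist V x" "y \<in> proj" "y \<odot> d = 0" "\<not> equidist V y"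
    using xy(1) unfolding uneven_orth_def by auto
  have cr: "cross x y \<noteq> 0" using proj_cross m xy(2) by blast
  have *: "plane_count V z r = k" if z: "z \<odot> d = 0" "cross x z \<noteq> 0" "cross z y \<noteq> 0" for z r
  proof (cases "equidist V z")
    case False
    obtain c v where "v \<in> uneven_orth V d" "z = c *s v"
      using uneven_orth_representative[OF cross_ne_0D(2)[OF z(2)] z(1) False] by metis
    then show ?thesis using xy(1) z(2,3) by (auto simp: cross_smult)
  qed (rule equidist_plane_count)
  have e: "plane_count V x s + plane_count V y t = 5 * line_count V x y s t + k" for s t
  proof -
    have "cross x (x + c *s y) \<noteq> 0" "cross (x + c *s y) y \<noteq> 0" if "c \<noteq> 0" for c
      using cross_lincomb(2)[of x 1 c y] cross_lincomb(1)[of 1 x c y] cr that smult_eq_0_iff by auto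
    then have "(\<Sum>c\<in>UNIV - {0}. plane_count V (x + c *s y) (s + c * t)) = (\<Sum>c\<in>UNIV - {0 :: 5}. k)"
      by (intro sum.cong refl *) (auto simp: m)
    moreover have "(\<Sum>c\<in>UNIV. plane_count V (x + c *s y) (s + c * t)) =
        plane_count V x s + (\<Sum>c\<in>UNIV - {0}. plane_count V (x + c *s y) (s + c * t))"
      by (subst sum.remove[of _ 0]) auto
    ultimately show ?thesis using six_planes[of V y t x s] by (simp add: card_V)
  qed
  \<comment> \<open>Counts lie between 0 and 5, so a common nonzero residue would make them all
    equal, that is, make the direction even.\<close>
  have zero_or_5: "plane_count V z s mod 5 = 0"
    if z: "\<not> equidist V z" "z \<noteq> 0" and e: "\<And>s s'. plane_count V z s mod 5 = plane_count V z s' mod 5" for z s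
  proof (rule ccontr)
    assume n: "plane_count V z s mod 5 \<noteq> 0"
    have "plane_count V z s' = plane_count V z s" for s'
      using n e[of s s'] plane_le[OF z(2), of s] plane_le[OF z(2), of s']
      by (cases "plane_count V z s = 5"; cases "plane_count V z s' = 5") auto
    then have c: "plane_count V z s' = plane_count V z s''" for s' s'' by metis
    have "5 * plane_count V z s' = card V" for s'
    proof -
      have "card V = (\<Sum>s''\<in>(UNIV :: 5 set). plane_count V z s')"
        unfolding sum_plane_count[of V z, symmetric] by (intro sum.cong refl c)
      then show ?thesis by simp
    qed
    then show False using z(1) by (simp add: equidist_def)
  qed
  have mod_eq: "a mod 5 = a' mod 5" if "a + b = 5 * l + k" "a' + b = 5 * l' + k" for a b l a' l' :: nat
  proof -
    have "a + 5 * l' = a' + 5 * l" using that by simp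
    then have "(a + 5 * l') mod 5 = (a' + 5 * l) mod 5" by simp
    then show ?thesis by simp
  qed
  have "x \<noteq> 0" "y \<noteq> 0" using m(1,4) by auto
  have x0: "plane_count V x 0 mod 5 = 0"
    by (rule zero_or_5[OF m(3) \<open>x \<noteq> 0\<close>]) (rule mod_eq[OF e[of _ 0] e[of _ 0]])
  have y0: "plane_count V y 0 mod 5 = 0"
    by (rule zero_or_5[OF m(6) \<open>y \<noteq> 0\<close>])
      (rule mod_eq[of _ "plane_count V x 0", OF trans[OF add.commute e] trans[OF add.commute e]])
  obtain p q where "plane_count V x 0 = 5 * p" "plane_count V y 0 = 5 * q" using x0 y0 by fastforce
  then have "5 * (p + q) = 5 * line_count V x y 0 0 + k" using e[of 0 0] by simp
  then show False using k by presburger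
qed

end

section \<open>Unique uneven directions from coplanar points\<close>

lemma card_proj_ge:
  assumes S: "\<And>x y. x \<in> S \<Longrightarrow> y \<in> S \<Longrightarrow> x \<noteq> y \<Longrightarrow> cross x y \<noteq> 0"
    and P: "\<And>x. x \<in> S \<Longrightarrow> x \<noteq> 0 \<and> P x"
    and scale: "\<And>c x. c \<noteq> 0 \<Longrightarrow> P (c *s x) \<Longrightarrow> P x"
  shows "card S \<le> card {x \<in> proj. P x}"
proof -
  \<comment> \<open>Each vector goes to the representative of its line, and \<open>scale\<close>
    carries the property there.\<close>
  have "\<forall>x\<in>S. \<exists>r. r \<in> {x \<in> proj. P x} \<and> (\<exists>c. x = c *s r)"
  proof
    fix x assume x: "x \<in> S"
    obtain c r where "c \<noteq> 0" "r \<in> proj" "x = c *s r" using proj_exists P[OF x] by metis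
    then show "\<exists>r. r \<in> {x \<in> proj. P x} \<and> (\<exists>c. x = c *s r)" using P[OF x] scale by blast
  qed
  then obtain f where f: "\<And>x. x \<in> S \<Longrightarrow> f x \<in> {x \<in> proj. P x} \<and> (\<exists>c. x = c *s f x)" by metis
  have "inj_on f S"
  proof (rule inj_onI, rule ccontr)
    fix x y assume xy: "x \<in> S" "y \<in> S" "f x = f y" "x \<noteq> y"
    obtain c c' where "x = c *s f x" "y = c' *s f x" using f[OF xy(1)] f[OF xy(2)] xy(3) by metis
    then have "cross x y = 0" using cross_parallel[of c "f x" c'] by argo
    then show False using S xy by blast
  qed
  then show ?thesis by (rule card_inj_on_le) (use f in auto)
qed

text \<open>In coordinates along two sides of a triangle, these are the differences of a fourth
  point from the three vertices; one of them is parallel to no side.\<close>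

lemma F5_translate_good:
  fixes a b :: 5
  assumes "\<not> (a = 0 \<and> b = 0)" "\<not> (a = 1 \<and> b = 0)" "\<not> (a = 0 \<and> b = 1)"
  shows "a \<noteq> 0 \<and> b \<noteq> 0 \<and> a + b \<noteq> 0 \<or> a - 1 \<noteq> 0 \<and> b \<noteq> 0 \<and> a - 1 + b \<noteq> 0 \<or>
    a \<noteq> 0 \<and> b - 1 \<noteq> 0 \<and> a + (b - 1) \<noteq> 0"
  using assms F5_cases[of a] F5_cases[of b] by (elim disjE) simp_all

context spectral_pair
begin

text \<open>Four coplanar points, not all collinear, determine at least four of the six directions
  of their plane.\<close>

lemma card_uneven_orth_dual_four_points:
  assumes V: "a \<in> V" "b \<in> V" "c \<in> V" "e \<in> V" and "d \<noteq> 0"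
    and d: "(b - a) \<odot> d = 0" "(c - a) \<odot> d = 0" "(e - a) \<odot> d = 0"
    and cr: "cross (b - a) (c - a) \<noteq> 0" and e: "e \<noteq> a" "e \<noteq> b" "e \<noteq> c"
  shows "card (uneven_orth B d) = 1"
proof -
  interpret D: spectral_pair B V k by (rule dual)
  define u w where "u = b - a" and "w = c - a"
  have uw: "cross u w \<noteq> 0" "u \<odot> d = 0" "w \<odot> d = 0" using cr d by (auto simp: u_def w_def)
  obtain \<alpha> \<beta> where ab: "e - a = \<alpha> *s u + \<beta> *s w"
    using in_plane_span[OF uw(1) \<open>d \<noteq> 0\<close> uw(2,3) d(3)] .
  have eb: "e - b = (\<alpha> - 1) *s u + \<beta> *s w"
    using ab by (simp add: u_def vector_sub_rdistrib algebra_simps)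
  have ec: "e - c = \<alpha> *s u + (\<beta> - 1) *s w"
    using ab by (simp add: w_def vector_sub_rdistrib algebra_simps)
  have ne: "b \<noteq> a" "c \<noteq> a" "c \<noteq> b"
    using cr cross_smult(1)[of "b - a" 1] by (auto simp: cross_smult)
  \<comment> \<open>The three sides of the triangle give three directions; the fourth comes from
    joining \<open>e\<close> to a suitable vertex.\<close>
  obtain \<alpha>' \<beta>' where good: "\<alpha>' \<noteq> 0" "\<beta>' \<noteq> 0" "\<alpha>' + \<beta>' \<noteq> 0" "equidist B (\<alpha>' *s u + \<beta>' *s w)"
  proof -
    have "\<not> (\<alpha> = 0 \<and> \<beta> = 0)" "\<not> (\<alpha> = 1 \<and> \<beta> = 0)" "\<not> (\<alpha> = 0 \<and> \<beta> = 1)"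
      using e ab by (auto simp: u_def w_def)
    then show ?thesis
      using F5_translate_good[of \<alpha> \<beta>] that equidist_B[OF V(4,1) e(1)] equidist_B[OF V(4,2) e(2)]
        equidist_B[OF V(4,3) e(3)] unfolding ab eb ec by blast
  qed
  define z where "z = \<alpha>' *s u + \<beta>' *s w"
  define S where "S = {u, w, w - u, z}"
  have c1: "cross u (w - u) \<noteq> 0" "cross w (w - u) \<noteq> 0" 
    using cross_lincomb(2)[of u "-1" 1 w] cross_lincomb(2)[of w 1 "-1" u] uw(1) cross_commute
    by (auto simp: vector_sneg_minus1[symmetric])
  have c2: "cross u z \<noteq> 0" "cross w z \<noteq> 0"
    using cross_lincomb(2)[of u \<alpha>' \<beta>' w] cross_lincomb(1)[of \<alpha>' u \<beta>' w] good uw(1) cross_commute[of w z]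
    by (auto simp: z_def smult_eq_0_iff)
  have "cross (w - u) z = (- \<beta>' - \<alpha>') *s cross u w"
    using cross_lincomb(3)[of "-1" u 1 w \<alpha>' \<beta>'] by (simp add: z_def vector_sneg_minus1[symmetric])
  moreover have "- \<beta>' - \<alpha>' \<noteq> 0" using good(3) by (metis add.commute add.inverse_inverse diff_conv_add_uminus minus_add_distrib neg_equal_0_iff_equal)
  ultimately have c3: "cross (w - u) z \<noteq> 0" using uw(1) smult_eq_0_iff by metis
  have pw: "cross x y \<noteq> 0" if "x \<in> S" "y \<in> S" "x \<noteq> y" for x y
    using that c1 c2 c3 uw(1) cross_commute unfolding S_def by blast
  have "card S = 4"
  proof -
    have "x \<noteq> y" if "cross x y \<noteq> 0" for x y using that cross_smult(1)[of x 1] by auto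
    then show ?thesis using c1 c2 c3 uw(1) unfolding S_def by simp
  qed
  moreover have "card S \<le> card {x \<in> proj. x \<odot> d = 0 \<and> equidist B x}"
  proof (rule card_proj_ge[OF pw])
    fix x assume "x \<in> S"
    moreover have "equidist B u" "equidist B w" "equidist B (w - u)"
      using equidist_B[OF V(2,1)] equidist_B[OF V(3,1)] equidist_B[OF V(3,2)] ne by (auto simp: u_def w_def)
    moreover have "u \<noteq> 0" "w \<noteq> 0" "w - u \<noteq> 0" "z \<noteq> 0"
      using cross_ne_0D uw(1) c1(1) c2(1) by blast+
    ultimately show "x \<noteq> 0 \<and> x \<odot> d = 0 \<and> equidist B x"
      using good(4) uw by (auto simp: S_def z_def)
  next
    fix c x assume "c \<noteq> 0" "(c *s x) \<odot> d = 0 \<and> equidist B (c *s x)"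
    then show "x \<odot> d = 0 \<and> equidist B x" using equidist_scale[of c B x] F5_mult_eq_0[of c "x \<odot> d"] by simp
  qed
  moreover have "card {x \<in> proj. x \<odot> d = 0 \<and> equidist B x} + card (uneven_orth B d) = 6"
    unfolding card_proj_plane[OF \<open>d \<noteq> 0\<close>, symmetric] uneven_orth_def
    by (subst card_Un_disjoint[symmetric]) (auto intro!: arg_cong[of _ _ card])
  \<comment> \<open>Four even directions leave at most two uneven ones among six; neither none nor
    two can occur.\<close>
  ultimately have "card (uneven_orth B d) \<le> 2" by simp
  moreover have "card (uneven_orth B d) \<noteq> 0" using D.uneven_orth_nonempty[OF \<open>d \<noteq> 0\<close>] by simp
  ultimately show ?thesis using D.card_uneven_orth_ne_2[OF \<open>d \<noteq> 0\<close>] by linarith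
qed

text \<open>It remains to find four points of \<open>V\<close> in the plane that are not all
  collinear.\<close>

lemma card_uneven_orth_dual_plane:
  assumes "2 \<le> k" "d \<noteq> 0" "4 \<le> plane_count V d t"
  shows "card (uneven_orth B d) = 1"
proof -
  let ?T = "{v \<in> V. v \<odot> d = t}"
  have T: "4 \<le> card ?T" using assms(3) by (simp add: plane_count_def)
  have ex: "\<exists>x. x \<in> ?T \<and> x \<notin> S" if "card S < 4" "finite S" for S
    using card_mono[of S ?T] that T by fastforce
  obtain a where a: "a \<in> ?T" using ex[of "{}"] by auto
  obtain b where b: "b \<in> ?T" "b \<noteq> a" using ex[of "{a}"] by auto
  have "b - a \<noteq> 0" "(b - a) \<odot> d = 0" using a b by auto
  then obtain u where u: "u \<odot> (b - a) = 0" "cross d u \<noteq> 0"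
    using orthogonal_basis_exists[OF _ assms(2), of "b - a"] by (metis dot_commute)
  \<comment> \<open>For \<open>k\<close> at least 2, \<open>line_le\<close> allows a line of the
    plane at most 3 points if the plane has 4, and at most 4 if it has 5.\<close>
  have "line_count V d u t (a \<odot> u) < plane_count V d t"
    using line_le[OF u(2), of t "a \<odot> u"] plane_le[OF assms(2), of t] assms(1,3) by linarith
  then have "\<not> ?T \<subseteq> {v \<in> V. v \<odot> d = t \<and> v \<odot> u = a \<odot> u}"
    unfolding line_count_def plane_count_def by (metis (no_types, lifting) card_mono finite leD)
  then obtain c where c: "c \<in> ?T" "c \<odot> u \<noteq> a \<odot> u" by auto
  have cr: "cross (b - a) (c - a) \<noteq> 0"
  proof
    assume "cross (b - a) (c - a) = 0"
    then obtain r where "c - a = r *s (b - a)" using parallel_if_cross_0 \<open>b - a \<noteq> 0\<close> by metis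
    then have "(c - a) \<odot> u = r * ((b - a) \<odot> u)" by (simp only: dot_simps(7))
    then have "(c - a) \<odot> u = 0" using u(1) dot_commute[of u "b - a"] by simp
    then show False using c by simp
  qed
  have "card {a, b, c} < 4" by (rule le_less_trans[OF card_insert_le_m1[of 3]]) (auto intro: card_insert_le_m1)
  then obtain e where e: "e \<in> ?T" "e \<notin> {a, b, c}" using ex[of "{a, b, c}"] by auto
  show ?thesis
    by (rule card_uneven_orth_dual_four_points[of a b c e d]) (use a b c e cr assms in auto)
qed

text \<open>If all five counts were at most 3, their sum of at least 15 would force them all to be
  3.\<close>

lemma exists_big_plane:
  assumes "3 \<le> k" "\<not> equidist V x"
  obtains t where "4 \<le> plane_count V x t"
proof -
  have "False" if *: "\<And>t. \<not> 4 \<le> plane_count V x t"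
  proof -
    have s: "plane_count V x 0 + plane_count V x 1 + plane_count V x 2 + plane_count V x 3 + plane_count V x 4 = 5 * k"
      using sum_plane_count[of V x] by (simp add: sum_F5 card_V)
    then have "plane_count V x 0 = k \<and> plane_count V x 1 = k \<and> plane_count V x 2 = k \<and> plane_count V x 3 = k \<and> plane_count V x 4 = k"
      using *[of 0] *[of 1] *[of 2] *[of 3] *[of 4] assms(1) by linarith
    then have "\<forall>t. plane_count V x t = k" by (subst all_F5)
    then show False using assms(2) by (simp add: equidist_def card_V)
  qed
  then show ?thesis using that by blast
qed

lemma card_uneven_orth_dual_not_equidist:
  assumes "3 \<le> k" "x \<noteq> 0" "\<not> equidist V x"
  shows "card (uneven_orth B x) = 1"
proof -
  obtain t where "4 \<le> plane_count V x t" using exists_big_plane[OF assms(1,3)] .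
  then show ?thesis using card_uneven_orth_dual_plane assms by simp
qed

lemma plane_count_single:
  assumes "uneven_orth V d = {x}" "d \<noteq> 0"
  shows "plane_count V x t = 0 \<or> plane_count V x t = 5"
proof -
  have "x \<in> uneven_orth V d" using assms(1) by simp
  then have x: "x \<noteq> 0" "x \<odot> d = 0" by (auto simp: uneven_orth_def)
  obtain w where w: "w \<odot> d = 0" "cross x w \<noteq> 0" using orthogonal_basis_exists[OF assms(2) x] .
  have "plane_count V x t = 5 * line_count V x w t 0" using uneven_orth_single[OF assms(1) w] .
  then show ?thesis using plane_le[OF x(1), of t] by (cases "line_count V x w t 0") auto
qed

lemma sum_plane_count_squared_single:
  assumes "uneven_orth V d = {x}" "d \<noteq> 0"
  shows "(\<Sum>t\<in>UNIV. (plane_count V x t)\<^sup>2) = 25 * k"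
proof -
  have "(plane_count V x t)\<^sup>2 = 5 * plane_count V x t" for t using plane_count_single[OF assms, of t] by auto
  then have "(\<Sum>t\<in>UNIV. (plane_count V x t)\<^sup>2) = (\<Sum>t\<in>UNIV. 5 * plane_count V x t)" by (intro sum.cong refl)
  then show ?thesis using sum_plane_count[of V x] by (simp flip: sum_distrib_left add: card_V)
qed

text \<open>Go to the dual and back: \<open>B\<close> has a unique uneven \<open>y\<close>
  orthogonal to \<open>x\<close>, and \<open>V\<close> a unique uneven direction orthogonal to
  \<open>y\<close>, which must be \<open>x\<close>. So the counts for \<open>x\<close> are 0 or
  5.\<close>

lemma sum_plane_count_squared_not_equidist:
  assumes "3 \<le> k" "x \<in> proj" "\<not> equidist V x"
  shows "(\<Sum>t\<in>UNIV. (plane_count V x t)\<^sup>2) = 25 * k"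
proof -
  interpret D: spectral_pair B V k by (rule dual)
  have "x \<noteq> 0" using assms(2) by auto
  then obtain y where y: "uneven_orth B x = {y}" using card_uneven_orth_dual_not_equidist assms by (metis card_1_singletonE)
  then have "y \<in> uneven_orth B x" by simp
  then have y': "y \<noteq> 0" "\<not> equidist B y" "y \<odot> x = 0" by (auto simp: uneven_orth_def)
  obtain z where z: "uneven_orth V y = {z}"
    using D.card_uneven_orth_dual_not_equidist[OF assms(1) y'(1,2)] by (metis card_1_singletonE)
  have "x \<in> uneven_orth V y" using assms y' by (simp add: uneven_orth_def dot_commute)
  then show ?thesis using sum_plane_count_squared_single[OF z y'(1)] z by simp
qed

end

subsection \<open>Excluding \<open>k = 3\<close> and \<open>k = 4\<close>\<close>

text \<open>Both sides count the ordered pairs of points of \<open>V\<close> on a common plane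
  orthogonal to \<open>x\<close>.\<close>

lemma sum_plane_count_squared: "(\<Sum>t\<in>UNIV. (plane_count V x t)\<^sup>2) = (\<Sum>v\<in>V. \<Sum>v'\<in>V. of_bool (x \<odot> (v - v') = 0))"
proof -
  have "(\<Sum>v\<in>V. \<Sum>v'\<in>V. of_bool (x \<odot> (v - v') = 0)) = (\<Sum>v\<in>V. plane_count V x (v \<odot> x))"
    unfolding plane_count_def card_eq_sum_of_bool[OF finite]
    by (intro sum.cong refl) (auto simp: dot_commute[of x])
  also have "\<dots> = (\<Sum>t\<in>UNIV. \<Sum>v\<in>{v \<in> V. v \<odot> x = t}. plane_count V x (v \<odot> x))"
    by (rule sum.group[symmetric]) auto
  also have "\<dots> = (\<Sum>t\<in>UNIV. (plane_count V x t)\<^sup>2)"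
    by (intro sum.cong refl) (simp add: plane_count_def power2_eq_square)
  finally show ?thesis by simp
qed

lemma sum_pair_split:
  fixes g :: "'a \<Rightarrow> 'a \<Rightarrow> nat"
  assumes "finite A" "\<And>a. a \<in> A \<Longrightarrow> g a a = p" "\<And>a b. a \<in> A \<Longrightarrow> b \<in> A \<Longrightarrow> a \<noteq> b \<Longrightarrow> g a b = q"
  shows "(\<Sum>a\<in>A. \<Sum>b\<in>A. g a b) = card A * p + card A * (card A - 1) * q"
proof -
  have "(\<Sum>b\<in>A. g a b) = p + (card A - 1) * q" if a: "a \<in> A" for a
  proof -
    have "(\<Sum>b\<in>A. g a b) = g a a + (\<Sum>b\<in>A - {a}. g a b)" by (rule sum.remove[OF assms(1) a])
    moreover have "(\<Sum>b\<in>A - {a}. g a b) = (\<Sum>b\<in>A - {a}. q)" using assms(3) a by (intro sum.cong) auto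
    ultimately show ?thesis using assms(1,2) a by simp
  qed
  then have "(\<Sum>a\<in>A. \<Sum>b\<in>A. g a b) = (\<Sum>a\<in>A. p + (card A - 1) * q)" by (intro sum.cong refl)
  then show ?thesis by (simp add: algebra_simps)
qed

text \<open>A point paired with itself is counted for all 31 directions, two distinct points for the
  6 orthogonal to their difference.\<close>

lemma sum_sum_plane_count_squared:
  "(\<Sum>x\<in>proj. \<Sum>t\<in>UNIV. (plane_count V x t)\<^sup>2) = card V * 31 + card V * (card V - 1) * 6"
proof -
  have "(\<Sum>x\<in>proj. \<Sum>t\<in>UNIV. (plane_count V x t)\<^sup>2) =
      (\<Sum>v\<in>V. \<Sum>v'\<in>V. \<Sum>x\<in>proj. of_bool (x \<odot> (v - v') = 0))"
    unfolding sum_plane_count_squared by (subst sum.swap) (intro sum.cong refl sum.swap)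
  also have "\<dots> = (\<Sum>v\<in>V. \<Sum>v'\<in>V. card {x \<in> proj. x \<odot> (v - v') = 0})"
    by (simp only: card_eq_sum_of_bool[OF finite])
  also have "\<dots> = card V * 31 + card V * (card V - 1) * 6"
    by (rule sum_pair_split) (simp_all add: card_proj card_proj_plane del: dot_simps(6))
  finally show ?thesis .
qed

definition uneven :: "(5 ^ 3) set \<Rightarrow> (5 ^ 3) set" where
  "uneven V = {x \<in> proj. \<not> equidist V x}"

lemma card_uneven_orth_eq_sum: "card (uneven_orth V d) = (\<Sum>x\<in>uneven V. of_bool (d \<odot> x = 0))"
proof -
  have "uneven_orth V d = {x \<in> uneven V. d \<odot> x = 0}" by (auto simp: uneven_orth_def uneven_def dot_commute)
  then show ?thesis by (simp only: card_eq_sum_of_bool[OF finite])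
qed

lemma sum_card_uneven_orth: "(\<Sum>d\<in>proj. card (uneven_orth V d)) = 6 * card (uneven V)"
proof -
  have "(\<Sum>d\<in>proj. card (uneven_orth V d)) = (\<Sum>x\<in>uneven V. card {d \<in> proj. d \<odot> x = 0})"
    unfolding card_uneven_orth_eq_sum card_eq_sum_of_bool[OF finite] by (rule sum.swap)
  also have "\<dots> = (\<Sum>x\<in>uneven V. 6)"
    by (intro sum.cong refl card_proj_plane) (auto simp: uneven_def)
  finally show ?thesis by simp
qed

text \<open>Count triples \<open>d\<close>, \<open>x\<close>, \<open>y\<close> with \<open>x\<close>
  and \<open>y\<close> orthogonal to \<open>d\<close>: there are six \<open>d\<close> if
  \<open>x = y\<close> and one otherwise.\<close>

lemma sum_card_uneven_orth_squared:
  "(\<Sum>d\<in>proj. (card (uneven_orth V d))\<^sup>2) = card (uneven V) * 6 + card (uneven V) * (card (uneven V) - 1)"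
proof -
  have "(\<Sum>d\<in>proj. (card (uneven_orth V d))\<^sup>2) =
      (\<Sum>d\<in>proj. \<Sum>x\<in>uneven V. \<Sum>y\<in>uneven V. of_bool (d \<odot> x = 0 \<and> d \<odot> y = 0))"
    unfolding card_uneven_orth_eq_sum power2_eq_square sum_product of_bool_conj ..
  also have "\<dots> = (\<Sum>x\<in>uneven V. \<Sum>y\<in>uneven V. card {d \<in> proj. d \<odot> x = 0 \<and> d \<odot> y = 0})"
    unfolding card_eq_sum_of_bool[OF finite] by (subst sum.swap) (intro sum.cong refl sum.swap)
  also have "\<dots> = card (uneven V) * 6 + card (uneven V) * (card (uneven V) - 1) * 1"
  proof (rule sum_pair_split)
    fix x y assume x: "x \<in> uneven V"
    then have "x \<noteq> 0" by (auto simp: uneven_def)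
    then show "card {d \<in> proj. d \<odot> x = 0 \<and> d \<odot> x = 0} = 6" using card_proj_plane by simp
    assume "y \<in> uneven V" "x \<noteq> y"
    then have "cross x y \<noteq> 0" using x proj_cross by (auto simp: uneven_def)
    then show "card {d \<in> proj. d \<odot> x = 0 \<and> d \<odot> y = 0} = 1" by (rule card_proj_both)
  qed simp
  finally show ?thesis by simp
qed

context spectral_pair
begin

text \<open>In the total of squared plane counts an uneven direction contributes
  \<open>25 * k\<close> and an even one \<open>5 * k\<^sup>2\<close>; this is compared with the
  count by pairs.\<close>

lemma card_uneven:
  assumes "3 \<le> k"
  shows "(5 - k) * card (uneven V) = 25 - k"
proof -
  have "(\<Sum>x\<in>proj. \<Sum>t\<in>UNIV. (plane_count V x t)\<^sup>2) =
      (\<Sum>x\<in>uneven V. \<Sum>t\<in>UNIV. (plane_count V x t)\<^sup>2) + (\<Sum>x\<in>proj - uneven V. \<Sum>t\<in>UNIV. (plane_count V x t)\<^sup>2)"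
    by (subst sum.subset_diff[of "uneven V"]) (auto simp: uneven_def)
  moreover have "(\<Sum>x\<in>uneven V. \<Sum>t\<in>UNIV. (plane_count V x t)\<^sup>2) = (\<Sum>x\<in>uneven V. 25 * k)"
    using sum_plane_count_squared_not_equidist[OF assms] by (intro sum.cong refl) (auto simp: uneven_def)
  moreover have "(\<Sum>x\<in>proj - uneven V. \<Sum>t\<in>UNIV. (plane_count V x t)\<^sup>2) = (\<Sum>x\<in>proj - uneven V. 5 * k\<^sup>2)"
    by (intro sum.cong refl) (auto simp: uneven_def equidist_plane_count)
  moreover have "card (proj - uneven V) = 31 - card (uneven V)"
    by (subst card_Diff_subset) (auto simp: uneven_def card_proj)
  moreover have "card (uneven V) \<le> 31" unfolding card_proj[symmetric] by (rule card_mono) (auto simp: uneven_def)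
  moreover have "k = 3 \<or> k = 4" using k assms by auto
  ultimately show ?thesis using sum_sum_plane_count_squared[of V] unfolding card_V by (elim disjE) simp_all
qed

text \<open>There are 6 * 21 = 126 incidences, but the 21 uneven directions of \<open>B\<close> lie
  in one each and the other 10 in at most 6 each, at most 81 in all.\<close>

lemma k_ne_4: "k \<noteq> 4"
proof
  assume k4: "k = 4"
  interpret D: spectral_pair B V k by (rule dual)
  have sub: "uneven B \<subseteq> proj" by (auto simp: uneven_def)
  have m: "card (uneven V) = 21" "card (uneven B) = 21"
    using card_uneven D.card_uneven k4 by auto
  have "(\<Sum>d\<in>proj. card (uneven_orth V d)) = (\<Sum>d\<in>uneven B. card (uneven_orth V d)) + (\<Sum>d\<in>proj - uneven B. card (uneven_orth V d))"
    using sub by (subst sum.subset_diff[of "uneven B"]) auto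
  also have "(\<Sum>d\<in>uneven B. card (uneven_orth V d)) = (\<Sum>d\<in>uneven B. 1)"
    by (intro sum.cong refl D.card_uneven_orth_dual_not_equidist) (auto simp: uneven_def k4)
  also have "(\<Sum>d\<in>proj - uneven B. card (uneven_orth V d)) \<le> (\<Sum>d\<in>proj - uneven B. 6)"
    by (intro sum_mono card_uneven_orth_le) auto
  also have "card (proj - uneven B) = 10"
    using sub by (subst card_Diff_subset) (auto simp: card_proj m)
  then have "(\<Sum>d\<in>proj - uneven B. 6) = (60 :: nat)" by simp
  finally show False using sum_card_uneven_orth[of V] m by simp
qed

text \<open>The two moments of n = \<open>card (uneven_orth V d)\<close> give (n - 1)(n - 3) the
  total 5. For n = 1, 3, 4, 5, 6 its values are 0, 0, 3, 8, 15, which cannot add up to 5.\<close>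

lemma k_ne_3: "k \<noteq> 3"
proof
  assume k3: "k = 3"
  have m: "card (uneven V) = 11" using card_uneven k3 by auto
  define g where "g d = (int (card (uneven_orth V d)) - 1) * (int (card (uneven_orth V d)) - 3)" for d
  have "g d = int ((card (uneven_orth V d))\<^sup>2) - 4 * int (card (uneven_orth V d)) + 3" for d
    by (simp add: g_def algebra_simps power2_eq_square)
  then have "sum g proj = int (\<Sum>d\<in>proj. (card (uneven_orth V d))\<^sup>2) - 4 * int (\<Sum>d\<in>proj. card (uneven_orth V d)) + 3 * 31"
    by (simp add: sum.distrib sum_subtractf sum_distrib_left card_proj)
  then have s: "sum g proj = 5" unfolding sum_card_uneven_orth sum_card_uneven_orth_squared m by simp
  have g: "g d \<in> {0, 3} \<or> 8 \<le> g d" if "d \<in> proj" for d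
  proof -
    have "d \<noteq> 0" using that by auto
    then have "card (uneven_orth V d) \<noteq> 0" "card (uneven_orth V d) \<noteq> 2" "card (uneven_orth V d) \<le> 6"
      using uneven_orth_nonempty card_uneven_orth_ne_2 card_uneven_orth_le by auto
    then have "card (uneven_orth V d) = 1 \<or> card (uneven_orth V d) = 3 \<or> card (uneven_orth V d) = 4 \<or> card (uneven_orth V d) = 5 \<or> card (uneven_orth V d) = 6"
      by linarith
    then show ?thesis unfolding g_def by (elim disjE) simp_all
  qed
  show False
  proof (cases "\<exists>d\<in>proj. 8 \<le> g d")
    case True
    then obtain d where "d \<in> proj" "8 \<le> g d" by blast
    moreover have "g d \<le> sum g proj" using g \<open>d \<in> proj\<close> by (intro member_le_sum) force+
    ultimately show False using s by simp
  next
    case False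
    then have "3 dvd sum g proj" using g by (intro dvd_sum) fastforce
    then show False using s by simp
  qed
qed

end

subsection \<open>Excluding \<open>k = 2\<close>\<close>

lemma F5_periodic:
  fixes f :: "5 \<Rightarrow> 'a"
  assumes per: "\<And>t. f (t + h) = f t" and "h \<noteq> 0"
  shows "f t = f 0"
proof -
  define m where "m = t * h ^ 3"
  have t: "t = m * h"
    using inverse_F5[OF assms(2)] by (simp add: m_def mult.assoc mult.commute[of "h ^ 3"])
  have e: "f (0 * h) = f 0" "f (1 * h) = f (0 * h)" "f (2 * h) = f (1 * h)" "f (3 * h) = f (2 * h)" "f (4 * h) = f (3 * h)"
    using per[of 0] per[of h] per[of "2 * h"] per[of "3 * h"] by (simp_all add: algebra_simps)
  show ?thesis unfolding t using F5_cases[of m] e by (elim disjE) (simp_all only:)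
qed

lemma line_count_shift: "line_count V x (d + c *s x) j t = line_count V x d j (t - c * j)"
  unfolding line_count_def by (rule arg_cong[of _ _ card]) (auto simp: algebra_simps)

lemma line_count_le_plane_count: "line_count V u w s t \<le> plane_count V w t"
  unfolding line_count_def plane_count_def by (rule card_mono) auto

lemma sum_line_count: "(\<Sum>t\<in>UNIV. line_count V x d j t) = plane_count V x j"
proof -
  have "line_count V x d j t = plane_count {v \<in> V. v \<odot> x = j} d t" for t
    unfolding line_count_def plane_count_def by (rule arg_cong[of _ _ card]) auto
  then show ?thesis using sum_plane_count[of "{v \<in> V. v \<odot> x = j}" d] by (simp add: plane_count_def)
qed

context spectral_pair
begin

text \<open>The six planes through a line with two points of \<open>V\<close> have counts of total
  at least 20, more than 6 * 3.\<close>

lemma exists_plane_4: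
  assumes k2: "k = 2"
  obtains d t where "d \<noteq> 0" "4 \<le> plane_count V d t"
proof -
  have "2 \<le> card V" using card_V k2 by simp
  then obtain a b where ab: "a \<in> V" "b \<in> V" "a \<noteq> b"
    by (metis card_le_Suc0_iff_eq finite not_less_eq_eq numeral_2_eq_2)
  then have "a - b \<noteq> 0" by simp
  then obtain u where u: "u \<noteq> 0" "u \<odot> (a - b) = 0" using exists_orthogonal by metis
  obtain w where w: "w \<odot> (a - b) = 0" "cross u w \<noteq> 0"
    using orthogonal_basis_exists[OF \<open>a - b \<noteq> 0\<close> u] .
  have "card {a, b} \<le> line_count V u w (a \<odot> u) (a \<odot> w)"
    unfolding line_count_def using ab u w by (intro card_mono) (auto simp: dot_commute)
  then have line_count: "20 \<le> 5 * line_count V u w (a \<odot> u) (a \<odot> w) + card V" using ab card_V k2 by simp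
  have "u + c *s w \<noteq> 0" for c
    using cross_lincomb(1)[of 1 u c w] w(2) cross_ne_0D(1)[of "u + c *s w" w] by simp
  have False if *: "\<And>d t. d \<noteq> 0 \<Longrightarrow> plane_count V d t \<le> 3"
  proof -
    have "(\<Sum>c\<in>UNIV. plane_count V (u + c *s w) (a \<odot> u + c * (a \<odot> w))) \<le> (\<Sum>c\<in>(UNIV :: 5 set). 3)"
      by (intro sum_mono * \<open>\<And>c. u + c *s w \<noteq> 0\<close>)
    then show False
      using line_count six_planes[of V w "a \<odot> w" u "a \<odot> u"] *[OF cross_ne_0D(2)[OF w(2)], of "a \<odot> w"] by simp
  qed
  then show ?thesis using that by (metis not_less_eq_eq numeral_3_eq_3 numeral_eq_Suc pred_numeral_simps(2) semiring_norm(26) semiring_norm(27))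
qed

lemma two_planes:
  assumes "k = 2" "uneven_orth V d = {x}" "d \<noteq> 0"
  obtains t0 t1 where "t0 \<noteq> t1" "plane_count V x t0 = 5" "plane_count V x t1 = 5" "\<And>v. v \<in> V \<Longrightarrow> v \<odot> x = t0 \<or> v \<odot> x = t1"
proof -
  have *: "plane_count V x t = (if plane_count V x t = 5 then 5 else 0)" for t using plane_count_single[OF assms(2,3), of t] by auto
  have "5 * card {t. plane_count V x t = 5} = (\<Sum>t\<in>UNIV. if plane_count V x t = 5 then 5 else 0)"
    by (simp add: sum.If_cases)
  also have "\<dots> = (\<Sum>t\<in>UNIV. plane_count V x t)" by (intro sum.cong refl *[symmetric])
  finally have "card {t. plane_count V x t = 5} = 2" using sum_plane_count[of V x] card_V assms(1) by simp
  then obtain t0 t1 where t: "{t. plane_count V x t = 5} = {t0, t1}" "t0 \<noteq> t1" by (auto simp: card_2_iff)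
  have "v \<odot> x = t0 \<or> v \<odot> x = t1" if "v \<in> V" for v
  proof -
    have "plane_count V x (v \<odot> x) \<noteq> 0" unfolding plane_count_def using that by auto
    then have "v \<odot> x \<in> {t. plane_count V x t = 5}" using plane_count_single[OF assms(2,3), of "v \<odot> x"] by simp
    then show ?thesis unfolding t by simp
  qed
  moreover have "plane_count V x t0 = 5" "plane_count V x t1 = 5" using t(1) by auto
  ultimately show ?thesis using that t(2) by blast
qed

text \<open>The five points are spread evenly over the five lines \<open>v \<odot> y = s\<close> of
  the plane, so they form a graph over \<open>s\<close>.\<close>

lemma section_of_plane:
  assumes "uneven_orth V d = {x}" "y \<odot> d = 0" "cross x y \<noteq> 0" "plane_count V x t = 5"
  obtains \<sigma> where "\<And>s. \<sigma> s \<in> V" "\<And>s. \<sigma> s \<odot> x = t" "\<And>s. \<sigma> s \<odot> y = s"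
proof -
  have "\<exists>v. v \<in> V \<and> v \<odot> x = t \<and> v \<odot> y = s" for s
  proof -
    have "line_count V x y t s = 1" using uneven_orth_single[OF assms(1-3), of t s] assms(4) by simp
    then have "{v \<in> V. v \<odot> x = t \<and> v \<odot> y = s} \<noteq> {}" unfolding line_count_def by (metis card.empty zero_neq_one)
    then show ?thesis by blast
  qed
  then show ?thesis using that by metis
qed

lemma plane_count_two_planes:
  assumes "j0 \<noteq> j1" "\<And>v. v \<in> V \<Longrightarrow> v \<odot> x = j0 \<or> v \<odot> x = j1"
  shows "plane_count V d t = line_count V x d j0 t + line_count V x d j1 t"
proof -
  have "plane_count V d t = card ({v \<in> V. v \<odot> x = j0 \<and> v \<odot> d = t} \<union> {v \<in> V. v \<odot> x = j1 \<and> v \<odot> d = t})"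
    unfolding plane_count_def using assms(2) by (intro arg_cong[of _ _ card]) auto
  also have "\<dots> = line_count V x d j0 t + line_count V x d j1 t"
    unfolding line_count_def using assms(1) by (intro card_Un_disjoint) auto
  finally show ?thesis .
qed

text \<open>Moving \<open>d\<close> along \<open>x\<close> shifts the two halves of the pair against each other, so a second
  equidistributed direction forces both halves to be equidistributed.\<close>

lemma line_count_eq_1_if_equidist_shift:
  assumes k2: "k = 2" and j: "j0 \<noteq> j1" "plane_count V x j0 = 5" "\<And>v. v \<in> V \<Longrightarrow> v \<odot> x = j0 \<or> v \<odot> x = j1"
    and d: "equidist V d" "equidist V (d + c *s x)" "c \<noteq> 0"
  shows "line_count V x d j0 t = 1"
proof -
  define H where "H t = line_count V x d j0 t" for t
  define K where "K t = line_count V x d j1 t" for t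
  have HK: "H t + K t = 2" for t
    using equidist_plane_count[OF d(1), of t] plane_count_two_planes[OF j(1,3), of d t] k2 by (simp add: H_def K_def)
  have HK': "H (t - c * j0) + K (t - c * j1) = 2" for t
    using equidist_plane_count[OF d(2), of t] plane_count_two_planes[OF j(1,3), of "d + c *s x" t] k2
    by (simp add: H_def K_def line_count_shift)
  \<comment> \<open>The direction \<open>d + c *s x\<close> shifts the two halves by different
    amounts; eliminating \<open>K\<close> leaves a nonzero period of \<open>H\<close>.\<close>
  have "H (t + (c * j1 - c * j0)) = H t" for t
    using HK[of t] HK'[of "t + c * j1"] by (simp add: algebra_simps)
  moreover have "c * j1 - c * j0 \<noteq> 0" using j(1) d(3) F5_cancel[of c j1 j0] by auto
  ultimately have const: "H t = H 0" for t by (rule F5_periodic)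
  have "5 = (\<Sum>t\<in>UNIV. H t)" unfolding H_def sum_line_count using j(2) by simp
  also have "\<dots> = (\<Sum>t\<in>(UNIV :: 5 set). H 0)" by (intro sum.cong refl const)
  finally show ?thesis using const[of t] by (simp add: H_def)
qed

text \<open>Invariance would put all five points of the section on a line of direction
  \<open>r\<close>, against \<open>line_le\<close>.\<close>

lemma section_not_translation_invariant:
  assumes k2: "k = 2" and \<sigma>: "\<And>s. \<sigma> s \<in> V" "\<And>s. \<sigma> s \<odot> x = t" "\<And>s. \<sigma> s \<odot> y = s"
    and "x \<noteq> 0" "h \<noteq> 0"
  shows "\<not> (\<forall>s. \<sigma> (s + h) = \<sigma> s + r)"
proof
  assume *: "\<forall>s. \<sigma> (s + h) = \<sigma> s + r"
  have r: "r = \<sigma> (0 + h) - \<sigma> 0" using spec[OF *, of 0] by (metis add_diff_cancel_left')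
  then have "r \<odot> y = h" "x \<odot> r = 0" using \<sigma>(2,3) by (simp_all add: dot_commute[of x])
  then have "r \<noteq> 0" using assms(6) by auto
  obtain w where w: "w \<odot> r = 0" "cross x w \<noteq> 0"
    using orthogonal_basis_exists[OF \<open>r \<noteq> 0\<close> assms(5) \<open>x \<odot> r = 0\<close>] .
  have per: "\<sigma> (s + h) \<odot> w = \<sigma> s \<odot> w" for s using * w(1) by (simp add: dot_commute[of r])
  have const: "\<sigma> s \<odot> w = \<sigma> 0 \<odot> w" for s
    by (rule F5_periodic[of "\<lambda>s. \<sigma> s \<odot> w", OF per assms(6)])
  have "inj \<sigma>" using \<sigma>(3) by (metis injI)
  then have "5 = card (range \<sigma>)" by (simp add: card_image)
  also have "\<dots> \<le> line_count V x w t (\<sigma> 0 \<odot> w)"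
    unfolding line_count_def by (rule card_mono[OF finite]) (use \<sigma>(1,2) const in blast)
  finally show False using line_le[OF w(2), of t "\<sigma> 0 \<odot> w"] plane_le[OF assms(5), of t] k2 by linarith
qed

lemma k_ne_2: "k \<noteq> 2"
proof
  assume k2: "k = 2"
  interpret D: spectral_pair B V k by (rule dual)
  obtain d t where d: "d \<noteq> 0" "4 \<le> plane_count B d t" using D.exists_plane_4[OF k2] .
  have "card (uneven_orth V d) = 1" using D.card_uneven_orth_dual_plane[of d t] d k2 by simp
  then obtain \<eta> where uneven_orth_d: "uneven_orth V d = {\<eta>}" by (auto simp: card_1_singleton_iff)
  then have "\<eta> \<in> uneven_orth V d" by simp
  then have \<eta>: "\<eta> \<in> proj" "\<not> equidist V \<eta>" "\<eta> \<noteq> 0" by (auto simp: uneven_orth_def)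
  obtain t0 t1 where t: "t0 \<noteq> t1" "plane_count V \<eta> t0 = 5" "plane_count V \<eta> t1 = 5"
    using two_planes[OF k2 uneven_orth_d d(1)] by metis
  have "card (uneven_orth B \<eta>) = 1" using card_uneven_orth_dual_plane[of \<eta> t0] \<eta> t k2 by simp
  then obtain \<xi> where uneven_orth_\<eta>: "uneven_orth B \<eta> = {\<xi>}" by (auto simp: card_1_singleton_iff)
  then have "\<xi> \<in> uneven_orth B \<eta>" by simp
  then have \<xi>: "\<xi> \<noteq> 0" "\<xi> \<odot> \<eta> = 0" "\<eta> \<odot> \<xi> = 0" by (auto simp: uneven_orth_def dot_commute)
  obtain j0 j1 where j: "j0 \<noteq> j1" "plane_count B \<xi> j0 = 5" "\<And>v. v \<in> B \<Longrightarrow> v \<odot> \<xi> = j0 \<or> v \<odot> \<xi> = j1"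
    using D.two_planes[OF k2 uneven_orth_\<eta> \<eta>(3)] by metis
  \<comment> \<open>From here \<open>\<xi>\<close> replaces \<open>d\<close>: \<open>\<eta>\<close>
    is the only uneven direction of \<open>V\<close> orthogonal to \<open>\<xi>\<close>, and
    \<open>\<xi>\<close> the only one of \<open>B\<close> orthogonal to
    \<open>\<eta>\<close>.\<close>
  have "card (uneven_orth V \<xi>) = 1" using D.card_uneven_orth_dual_plane[of \<xi> j0] \<xi> j k2 by simp
  moreover have "\<eta> \<in> uneven_orth V \<xi>" using \<eta> \<xi> by (simp add: uneven_orth_def)
  ultimately have uneven_orth_\<xi>: "uneven_orth V \<xi> = {\<eta>}" by (auto simp: card_1_singleton_iff)

  obtain y where y: "y \<odot> \<xi> = 0" "cross \<eta> y \<noteq> 0" using orthogonal_basis_exists[OF \<xi>(1) \<eta>(3) \<xi>(3)] .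
  obtain e where e: "e \<odot> \<eta> = 0" "cross \<xi> e \<noteq> 0" using orthogonal_basis_exists[OF \<eta>(3) \<xi>(1,2)] .
  obtain \<sigma> where \<sigma>: "\<And>s. \<sigma> s \<in> V" "\<And>s. \<sigma> s \<odot> \<eta> = t0" "\<And>s. \<sigma> s \<odot> y = s"
    using section_of_plane[OF uneven_orth_\<xi> y t(2)] by metis
  obtain \<tau> where \<tau>: "\<And>s. \<tau> s \<in> V" "\<And>s. \<tau> s \<odot> \<eta> = t1" "\<And>s. \<tau> s \<odot> y = s"
    using section_of_plane[OF uneven_orth_\<xi> y t(3)] by metis
  have diff: "equidist B (\<tau> s' - \<sigma> s)" for s s'
    using equidist_B[OF \<tau>(1) \<sigma>(1)] \<sigma>(2) \<tau>(2) t(1) by metis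

  \<comment> \<open>All differences \<open>\<tau> (r + s) - \<sigma> r\<close> have the same
    products with \<open>\<eta>\<close> and \<open>y\<close>, so they agree with
    \<open>\<delta> s\<close> up to multiples of \<open>\<xi>\<close>.\<close>
  define \<delta> where "\<delta> s = \<tau> s - \<sigma> 0" for s
  \<comment> \<open>If some difference deviates from \<open>\<delta> s\<close>, it is a second even
    direction, and the half of \<open>B\<close> at level \<open>j0\<close> is equidistributed along
    \<open>\<delta> s\<close>.\<close>
  have translate: "\<tau> (r + s) = \<sigma> r + \<delta> s" if bad: "line_count B \<xi> (\<delta> s) j0 l \<noteq> 1" for r s l
  proof (rule ccontr)
    assume ne: "\<tau> (r + s) \<noteq> \<sigma> r + \<delta> s"
    let ?z = "(\<tau> (r + s) - \<sigma> r) - \<delta> s"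
    have "?z \<odot> \<eta> = 0" "?z \<odot> y = 0" by (simp_all add: \<delta>_def \<sigma> \<tau>)
    then obtain c where c: "?z = c *s cross \<eta> y" using orthogonal_both y(2) by metis
    obtain c' where c': "\<xi> = c' *s cross \<eta> y"
      using orthogonal_both[OF \<xi>(2) _ y(2)] y(1) dot_commute[of \<xi> y] by metis
    have "c \<noteq> 0" using c ne by (auto simp: algebra_simps)
    have "c' \<noteq> 0" using c' \<xi>(1) by auto
    have "?z = (c * c' ^ 3) *s \<xi>"
      unfolding c c' vector_smult_assoc using inverse_F5[OF \<open>c' \<noteq> 0\<close>] by (simp add: mult.assoc mult.commute[of "c' ^ 3"])
    then have "\<tau> (r + s) - \<sigma> r = \<delta> s + (c * c' ^ 3) *s \<xi>" by (simp add: algebra_simps)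
    then have "equidist B (\<delta> s + (c * c' ^ 3) *s \<xi>)" using diff by metis
    moreover have "c * c' ^ 3 \<noteq> 0"
      using \<open>c \<noteq> 0\<close> inverse_F5[OF \<open>c' \<noteq> 0\<close>] F5_mult_eq_0[of c "c' ^ 3"] by auto
    ultimately have "line_count B \<xi> (\<delta> s) j0 l = 1"
      using D.line_count_eq_1_if_equidist_shift[OF k2 j, of "\<delta> s" "c * c' ^ 3" l] diff by (simp add: \<delta>_def)
    then show False using bad by simp
  qed
  \<comment> \<open>Two bad indices would make \<open>\<sigma>\<close> invariant under the
    translation by their difference.\<close>
  have bad_unique: "s = s'" if bad: "line_count B \<xi> (\<delta> s) j0 l \<noteq> 1" "line_count B \<xi> (\<delta> s') j0 l' \<noteq> 1" for s s' l l'
  proof (rule ccontr)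
    assume "s \<noteq> s'"
    have "\<sigma> (r + (s - s')) = \<sigma> r + (\<delta> s - \<delta> s')" for r
      using translate[OF bad(1), of r] translate[OF bad(2), of "r + (s - s')"] by (simp add: algebra_simps)
    then show False
      using section_not_translation_invariant[OF k2 \<sigma> \<eta>(3), of "s - s'"] \<open>s \<noteq> s'\<close> by auto
  qed

  have ey: "e \<odot> y \<noteq> 0"
  proof
    assume "e \<odot> y = 0"
    then obtain c where c: "e = c *s cross \<eta> y" using orthogonal_both e(1) y(2) by metis
    obtain c' where "\<xi> = c' *s cross \<eta> y"
      using orthogonal_both[OF \<xi>(2) _ y(2)] y(1) dot_commute[of \<xi> y] by metis
    then have "cross \<xi> e = 0" using c cross_parallel by metis
    then show False using e(2) by simp
  qed
  \<comment> \<open>Points of the half at level \<open>j0\<close> on the plane through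
    \<open>b\<close> normal to \<open>\<delta> 0 + c *s e\<close>. Together with \<open>e\<close>
    these normals give all six directions needed for \<open>six_planes\<close>.\<close>
  define f where "f b c = line_count B \<xi> (\<delta> 0 + c *s e) j0 (b \<odot> (\<delta> 0 + c *s e))" for b c
  \<comment> \<open>The \<open>e\<close>-coordinate of \<open>\<delta> s - \<delta> 0\<close> is
    \<open>s\<close> divided by \<open>e \<odot> y\<close>; its multiple of \<open>\<xi>\<close> is
    constant on the half and only relabels the lines.\<close>
  have s_of: "\<exists>l. f b (s * (e \<odot> y) ^ 3) = line_count B \<xi> (\<delta> s) j0 l" for b s
  proof -
    have "(\<delta> s - \<delta> 0) \<odot> \<eta> = 0" by (simp add: \<delta>_def \<tau> \<sigma>)
    then obtain \<alpha> \<beta> where ab: "\<delta> s - \<delta> 0 = \<alpha> *s \<xi> + \<beta> *s e"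
      using in_plane_span[OF e(2) \<eta>(3) \<xi>(2) e(1)] by metis
    have "(\<delta> s - \<delta> 0) \<odot> y = s" by (simp add: \<delta>_def \<tau> \<sigma>)
    then have "\<beta> * (e \<odot> y) = s" using y(1) by (simp add: ab dot_commute[of y])
    then have "\<beta> = s * (e \<odot> y) ^ 3" using inverse_F5[OF ey] by (metis mult.assoc mult.right_neutral)
    then have "\<delta> 0 + (s * (e \<odot> y) ^ 3) *s e = \<delta> s + (- \<alpha>) *s \<xi>" using ab by (simp add: algebra_simps vector_smult_lneg)
    then show ?thesis unfolding f_def using line_count_shift[of B \<xi> "\<delta> s" "- \<alpha>" j0] by metis
  qed
  have bad_unique': "c = c'" if "f b c \<noteq> 1" "f b c' \<noteq> 1" for b c c'
  proof -
    have c: "c = (c * (e \<odot> y)) * (e \<odot> y) ^ 3" for c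
      using inverse_F5[OF ey] by (simp add: mult.assoc)
    have "c * (e \<odot> y) = c' * (e \<odot> y)"
      using bad_unique s_of[of b "c * (e \<odot> y)"] s_of[of b "c' * (e \<odot> y)"] that c by metis
    then show ?thesis using c by metis
  qed
  have f_le: "f b c \<le> 4" for b c
  proof -
    have "cross \<xi> (\<delta> 0 + c *s e) \<noteq> 0"
    proof
      assume "cross \<xi> (\<delta> 0 + c *s e) = 0"
      then obtain r where "\<delta> 0 + c *s e = r *s \<xi>" using parallel_if_cross_0 \<xi>(1) by metis
      then have "(\<delta> 0 + c *s e) \<odot> \<eta> = r * (\<xi> \<odot> \<eta>)" by (simp only: dot_simps)
      then show False using \<xi>(2) e(1) t(1) by (simp add: \<delta>_def \<tau> \<sigma>)
    qed
    from D.line_le[OF this, of j0 "b \<odot> (\<delta> 0 + c *s e)"] show ?thesis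
      using j(2) k2 by (simp add: f_def)
  qed
  obtain b where b: "b \<in> B" "b \<odot> \<xi> = j0" 
  proof -
    have "{b \<in> B. b \<odot> \<xi> = j0} \<noteq> {}"
      using j(2) unfolding plane_count_def by (metis card.empty zero_neq_numeral)
    then show ?thesis using that by auto
  qed
  let ?B = "{b \<in> B. b \<odot> \<xi> = j0}"
  have plane_count_B: "plane_count ?B u l = line_count B \<xi> u j0 l" for u l
    unfolding plane_count_def line_count_def by (rule arg_cong[of _ _ card]) auto
  have "line_count B \<xi> e j0 (b \<odot> e) = 1" using D.uneven_orth_single[OF uneven_orth_\<eta> e, of j0 "b \<odot> e"] j(2) by simp
  then have pe: "plane_count ?B e (b \<odot> e) = 1" by (simp add: plane_count_B)
  have "line_count ?B (\<delta> 0) e (b \<odot> \<delta> 0) (b \<odot> e) \<noteq> 0" unfolding line_count_def using b by auto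
  then have "line_count ?B (\<delta> 0) e (b \<odot> \<delta> 0) (b \<odot> e) = 1"
    using line_count_le_plane_count[of ?B "\<delta> 0" e "b \<odot> \<delta> 0" "b \<odot> e"] pe by simp
  moreover have "card ?B = 5" using j(2) by (simp add: plane_count_def)
  \<comment> \<open>The plane normal to \<open>e\<close> contains only \<open>b\<close> from the
    half, so the other five planes count \<open>b\<close> five times and each of the four other
    points once.\<close>
  ultimately have sum_f: "(\<Sum>c\<in>UNIV. f b c) = 9"
    using six_planes[of ?B e "b \<odot> e" "\<delta> 0" "b \<odot> \<delta> 0"] pe by (simp add: plane_count_B f_def)
  show False
  \<comment> \<open>At most one of the five summands differs from 1, and it is at most 4, so the sum
    is at most 8.\<close>
  proof (cases "\<exists>c. f b c \<noteq> 1")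
    case True
    then obtain c where c: "f b c \<noteq> 1" by blast
    have "(\<Sum>c'\<in>UNIV - {c}. f b c') = (\<Sum>c'\<in>UNIV - {c}. 1)"
      using bad_unique'[OF c] by (intro sum.cong refl) blast
    then have "(\<Sum>c'\<in>UNIV - {c}. f b c') = 4" by simp
    moreover have "(\<Sum>c\<in>UNIV. f b c) = f b c + (\<Sum>c'\<in>UNIV - {c}. f b c')"
      by (rule sum.remove) auto
    ultimately show False using sum_f f_le[of b c] by linarith
  next
    case False
    then show False using sum_f by simp
  qed
qed

end

lemma spectral_pair_False:
  assumes "card V = 5 * k" "card B = 5 * k" "1 < k" "k < 5"
    and "\<And>b b'. b \<in> B \<Longrightarrow> b' \<in> B \<Longrightarrow> b \<noteq> b' \<Longrightarrow> equidist V (b - b')"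
    and "\<And>v v'. v \<in> V \<Longrightarrow> v' \<in> V \<Longrightarrow> v \<noteq> v' \<Longrightarrow> equidist B (v - v')"
  shows False
proof -
  interpret spectral_pair V B k by unfold_locales (use assms in auto)
  show False using k_ne_2 k_ne_3 k_ne_4 assms(3,4) by linarith
qed

subsection \<open>Exponential sums\<close>

definition e5 :: "5 \<Rightarrow> complex" where
  "e5 t = exp (2 * of_real pi * \<i> * of_int (Rep_bit1 t) / 5)"

text \<open>Any integer representative may be used, as multiples of 5 contribute full turns.\<close>

lemma e5_of_int: "e5 (of_int n) = exp (2 * of_real pi * \<i> * of_int n / 5)"
proof -
  have "Rep_bit1 (of_int n :: 5) = n mod 5"
    using bit1.of_int_eq[of n, where 'a = "2"] bit1.Rep_Abs_mod[of n, where 'a = "2"] by simp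
  then have "e5 (of_int n) = exp (2 * of_real pi * \<i> * of_int (n mod 5) / 5)" by (simp add: e5_def)
  also have "\<dots> = exp (2 * of_real pi * \<i> * of_int (n mod 5) / 5) * exp (2 * of_int (n div 5) * of_real pi * \<i>)"
    using exp_integer_2pi[of "of_int (n div 5)"] by simp
  also have "\<dots> = exp (2 * of_real pi * \<i> * of_int n / 5)"
  proof -
    have n: "of_int n = of_int (n mod 5) + 5 * (of_int (n div 5) :: complex)"
      by (metis mod_mult_div_eq of_int_add of_int_mult of_int_numeral)
    show ?thesis unfolding n exp_add[symmetric] by (rule arg_cong[of _ _ exp]) (simp add: field_simps)
  qed
  finally show ?thesis .
qed

lemma e5_add: "e5 (s + t) = e5 s * e5 t"
proof -
  obtain a b where "s = of_int a" "t = of_int b" by (metis bit1_cases)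
  then show ?thesis
    by (simp add: e5_of_int exp_add[symmetric] add_divide_distrib[symmetric] distrib_left[symmetric]
        flip: of_int_add)
qed

lemma cnj_e5: "cnj (e5 t) = e5 (- t)"
proof -
  obtain a where "t = of_int a" by (metis bit1_cases)
  moreover have "e5 (- t) = exp (2 * of_real pi * \<i> * of_int (- a) / 5)"
    using e5_of_int[of "- a"] \<open>t = of_int a\<close> by simp
  ultimately show ?thesis by (simp add: e5_of_int exp_cnj)
qed

lemma e5_0 [simp]: "e5 0 = 1"
  using e5_of_int[of 0] by simp

lemma e5_power: "e5 2 = e5 1 ^ 2" "e5 3 = e5 1 ^ 3" "e5 4 = e5 1 ^ 4" "e5 1 ^ 5 = 1"
proof -
  show 2: "e5 2 = e5 1 ^ 2" using e5_add[of 1 1] by (simp add: power2_eq_square)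
  show 3: "e5 3 = e5 1 ^ 3" using e5_add[of 2 1] 2 by (simp add: power3_eq_cube power2_eq_square)
  show 4: "e5 4 = e5 1 ^ 4" using e5_add[of 3 1] 3 by (simp add: power4_eq_xxxx power3_eq_cube)
  have "(4 :: 5) + 1 = 0" by simp
  then have "e5 4 * e5 1 = 1" using e5_add[of 4 1] e5_0 by metis
  then show "e5 1 ^ 5 = 1" using 4 by (simp add: eval_nat_numeral mult.assoc)
qed

lemma Im_e5_1: "Im (e5 1) > 0"
proof -
  have "e5 1 = exp (\<i> * of_real (2 * pi / 5))" using e5_of_int[of 1] by (simp add: field_simps)
  then have "Im (e5 1) = sin (2 * pi / 5)" by (simp add: Im_exp)
  moreover have "sin (2 * pi / 5) > 0" by (rule sin_gt_zero) auto
  ultimately show ?thesis by simp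
qed

section \<open>Integer relations between fifth roots of unity\<close>

lemma int_golden_ratio_irrational:
  fixes p q :: int assumes "p\<^sup>2 = p * q + q\<^sup>2" shows "q = 0"
  using assms
proof (induction "nat \<bar>q\<bar>" arbitrary: p q rule: less_induct)
  case less
  show ?case
  proof (rule ccontr)
    assume q: "q \<noteq> 0"
    \<comment> \<open>Infinite descent: modulo 2 the equation has only the zero solution, so both
      numbers can be halved.\<close>
    have "even p \<and> even q"
    proof -
      have "even (p\<^sup>2) \<longleftrightarrow> even (p * q + q\<^sup>2)" using less.prems by simp
      then show ?thesis by (auto simp: power2_eq_square)
    qed
    then obtain p' q' where e: "p = 2 * p'" "q = 2 * q'" by (auto elim!: evenE)
    then have "p'\<^sup>2 = p' * q' + q'\<^sup>2" using less.prems by (simp add: power2_eq_square)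
    moreover have "\<bar>q'\<bar> < \<bar>q\<bar>" using q e by (simp add: abs_mult)
    ultimately have "q' = 0" using less.hyps[of q' p'] by simp
    then show False using q e by simp
  qed
qed

lemma golden_ratio_irrational:
  fixes r :: complex and p q :: int
  assumes "r\<^sup>2 + r = 1" "of_int p + of_int q * r = 0"
  shows "q = 0" "p = 0"
proof -
  have p: "of_int p = - (of_int q * r)" using assms(2) by (simp add: eq_neg_iff_add_eq_0)
  have "of_int (p\<^sup>2) = (of_int (p * q + q\<^sup>2) :: complex)"
  proof -
    have r: "r\<^sup>2 = 1 - r" using assms(1) by (simp add: eq_diff_eq)
    show ?thesis unfolding of_int_power of_int_add of_int_mult p
      by (simp add: power_mult_distrib r) (simp add: power2_eq_square algebra_simps)
  qed
  then have "p\<^sup>2 = p * q + q\<^sup>2" by (simp only: of_int_eq_iff)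
  then show "q = 0" by (rule int_golden_ratio_irrational)
  then show "p = 0" using p by simp
qed

text \<open>A relation is added to and subtracted from its complex conjugate. Both results reduce to
  integer relations between 1 and \<open>x = z + z ^ 4\<close>, a root of
  \<open>x\<^sup>2 + x = 1\<close>, which is irrational.\<close>

lemma sum_e5_eq_0_iff:
  fixes n :: "5 \<Rightarrow> int"
  shows "(\<Sum>t\<in>UNIV. of_int (n t) * e5 t) = 0 \<longleftrightarrow> (\<forall>t. n t = n 0)"
proof -
  define z where "z = e5 1"
  have z5: "z ^ 5 = 1" and e: "e5 1 = z" "e5 2 = z ^ 2" "e5 3 = z ^ 3" "e5 4 = z ^ 4"
    by (simp_all add: z_def e5_power)
  have "z \<noteq> 1" using Im_e5_1 by (auto simp: z_def)
  have "(z - 1) * (1 + z + z ^ 2 + z ^ 3 + z ^ 4) = z ^ 5 - 1"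
    by (simp add: algebra_simps eval_nat_numeral)
  then have s0: "1 + z + z ^ 2 + z ^ 3 + z ^ 4 = 0" using z5 \<open>z \<noteq> 1\<close> by simp
  show ?thesis
  proof
    assume "\<forall>t. n t = n 0"
    then have "(\<Sum>t\<in>UNIV. of_int (n t) * e5 t) = (\<Sum>t\<in>UNIV. of_int (n 0) * e5 t)"
      by (intro sum.cong refl) metis
    also have "\<dots> = of_int (n 0) * (1 + z + z ^ 2 + z ^ 3 + z ^ 4)"
      by (simp add: sum_distrib_left[symmetric] sum_F5 e)
    finally show "(\<Sum>t\<in>UNIV. of_int (n t) * e5 t) = 0" using s0 by simp
  next
    assume "(\<Sum>t\<in>UNIV. of_int (n t) * e5 t) = 0"
    then have S: "of_int (n 0) + of_int (n 1) * z + of_int (n 2) * z ^ 2 + of_int (n 3) * z ^ 3 + of_int (n 4) * z ^ 4 = 0"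
      by (simp add: sum_F5 e)
    have "- 1 = (4 :: 5)" by (rule minus_unique) simp
    then have cz: "cnj z = z ^ 4" using cnj_e5[of 1] e(4) by (simp only: z_def)
    have z6: "z ^ 8 = z ^ 3" "z ^ 12 = z ^ 2" "z ^ 16 = z" "z ^ 6 = z"
    proof -
      have "z ^ 8 = z ^ 5 * z ^ 3" "z ^ 12 = z ^ 5 * z ^ 5 * z ^ 2" "z ^ 16 = z ^ 5 * z ^ 5 * z ^ 5 * z" "z ^ 6 = z ^ 5 * z"
        by (simp_all add: eval_nat_numeral)
      then show "z ^ 8 = z ^ 3" "z ^ 12 = z ^ 2" "z ^ 16 = z" "z ^ 6 = z" using z5 by simp_all
    qed
    have S': "of_int (n 0) + of_int (n 1) * z ^ 4 + of_int (n 2) * z ^ 3 + of_int (n 3) * z ^ 2 + of_int (n 4) * z = 0"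
      using arg_cong[OF S, of cnj] by (simp add: cz power_mult[symmetric] z6)
    define x where "x = z + z ^ 4"
    have x2: "x\<^sup>2 + x = 1"
    proof -
      have "x\<^sup>2 = z ^ 2 + 2 * z ^ 5 + z ^ 8" by (simp add: x_def power2_eq_square algebra_simps eval_nat_numeral)
      then show ?thesis using s0 z5 z6 by (simp add: x_def algebra_simps)
    qed
    have y: "z ^ 2 + z ^ 3 = - 1 - x" using s0 by (simp add: x_def algebra_simps eq_neg_iff_add_eq_0)
    have "of_int (2 * n 0 - (n 2 + n 3)) + of_int (n 1 + n 4 - (n 2 + n 3)) * x =
        2 * of_int (n 0) + of_int (n 1 + n 4) * x + of_int (n 2 + n 3) * (z ^ 2 + z ^ 3)"
      unfolding y by (simp add: algebra_simps)
    also have "\<dots> = 0" using arg_cong2[OF S S', of "(+)"] by (simp add: x_def algebra_simps)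
    finally have 1: "n 1 + n 4 - (n 2 + n 3) = 0" "2 * n 0 - (n 2 + n 3) = 0"
      using golden_ratio_irrational[OF x2] by blast+
    \<comment> \<open>This extracts the nonzero factor \<open>z - z ^ 4\<close> from the difference
      of the relation and its conjugate.\<close>
    have "(z - z ^ 4) * x = z ^ 2 - z ^ 8" by (simp add: x_def algebra_simps eval_nat_numeral)
    then have zx: "(z - z ^ 4) * x = z ^ 2 - z ^ 3" using z6 by simp
    have "(z - z ^ 4) * (of_int (n 1 - n 4) + of_int (n 2 - n 3) * x) =
        of_int (n 1 - n 4) * (z - z ^ 4) + of_int (n 2 - n 3) * (z ^ 2 - z ^ 3)"
      unfolding zx[symmetric] by (simp add: algebra_simps)
    also have "\<dots> = 0" using arg_cong2[OF S S', of "(-)"] by (simp add: algebra_simps)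
    finally have "(z - z ^ 4) * (of_int (n 1 - n 4) + of_int (n 2 - n 3) * x) = 0" .
    moreover have "z \<noteq> z ^ 4"
    proof
      assume "z = z ^ 4"
      then have "Im z = Im (cnj z)" using cz by simp
      then show False using Im_e5_1 by (simp add: z_def)
    qed
    ultimately have "of_int (n 1 - n 4) + of_int (n 2 - n 3) * x = 0" by simp
    then have 2: "n 2 - n 3 = 0" "n 1 - n 4 = 0" using golden_ratio_irrational[OF x2] by blast+
    have "n 1 = n 0" "n 2 = n 0" "n 3 = n 0" "n 4 = n 0" using 1 2 by presburger+
    then show "\<forall>t. n t = n 0" unfolding all_F5 by blast
  qed
qed

lemma chi_eq: "chi b x = e5 (x \<odot> b)"
  by (simp add: chi_def e5_def)

lemma chi_commute: "chi b x = chi x b"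
  by (simp add: chi_eq dot_commute)

lemma chi_add: "chi b (x + y) = chi b x * chi b y"
  by (simp add: chi_eq e5_add)

lemma chi_mult_cnj: "chi b x * cnj (chi b' x) = chi (b - b') x"
  using e5_add[of "x \<odot> b" "- (x \<odot> b')"] by (simp add: chi_eq cnj_e5)

lemma chi_0 [simp]: "chi 0 x = 1"
  by (simp add: chi_eq)

lemma sum_chi_eq_0_iff: "(\<Sum>x\<in>V. chi d x) = 0 \<longleftrightarrow> equidist V d"
proof -
  have "(\<Sum>x\<in>V. chi d x) = (\<Sum>t\<in>UNIV. \<Sum>x\<in>{x \<in> V. x \<odot> d = t}. chi d x)"
    by (rule sum.group[symmetric]) auto
  also have "\<dots> = (\<Sum>t\<in>UNIV. of_int (int (plane_count V d t)) * e5 t)"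
    by (intro sum.cong refl) (simp add: chi_eq plane_count_def)
  finally have "(\<Sum>x\<in>V. chi d x) = 0 \<longleftrightarrow> (\<forall>t. plane_count V d t = plane_count V d 0)"
    using sum_e5_eq_0_iff[of "\<lambda>t. int (plane_count V d t)"] by simp
  also have "\<dots> \<longleftrightarrow> equidist V d"
  proof
    assume *: "\<forall>t. plane_count V d t = plane_count V d 0"
    have "card V = (\<Sum>t\<in>(UNIV :: 5 set). plane_count V d 0)"
      unfolding sum_plane_count[of V d, symmetric] using * by (intro sum.cong refl) blast
    then have "card V = 5 * plane_count V d 0" by simp
    then show "equidist V d" unfolding equidist_def using * by metis
  next
    assume *: "equidist V d"
    show "\<forall>t. plane_count V d t = plane_count V d 0"
    proof
      fix t
      have "5 * plane_count V d t = 5 * plane_count V d 0" using * unfolding equidist_def by metis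
      then show "plane_count V d t = plane_count V d 0" by simp
    qed
  qed
  finally show ?thesis .
qed

subsection \<open>Spectra, tilings and equidistribution\<close>

lemma inner_L2_chi:
  "inner_L2 V (restr V (chi b)) (restr V (chi b')) = (\<Sum>x\<in>V. chi (b - b') x)"
  unfolding inner_L2_def by (intro sum.cong refl) (simp add: restr_def chi_mult_cnj)

lemma inner_L2_chi_eq_0_iff:
  "inner_L2 V (restr V (chi b)) (restr V (chi b')) = 0 \<longleftrightarrow> equidist V (b - b')"
  by (simp add: inner_L2_chi sum_chi_eq_0_iff)

text \<open>Expanding the indicator of \<open>v'\<close> in the basis and evaluating it at
  \<open>v\<close> gives the dual orthogonality over \<open>B\<close>; the case
  \<open>v = v'\<close> gives \<open>card B = card V\<close>.\<close>

lemma spectral_equidist: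
  assumes "spectral V" "V \<noteq> {}"
  obtains B where "card B = card V"
    "\<And>b b'. b \<in> B \<Longrightarrow> b' \<in> B \<Longrightarrow> b \<noteq> b' \<Longrightarrow> equidist V (b - b')"
    "\<And>v v'. v \<in> V \<Longrightarrow> v' \<in> V \<Longrightarrow> v \<noteq> v' \<Longrightarrow> equidist B (v - v')"
proof -
  let ?e = "\<lambda>b. restr V (chi b)"
  obtain B where inj: "inj_on ?e B" and ob: "orthogonal_basis V (?e ` B)"
    using assms(1) unfolding spectral_def by blast
  have equidist: "equidist V (b - b')" if "b \<in> B" "b' \<in> B" "b \<noteq> b'" for b b'
  proof -
    have "?e b \<noteq> ?e b'" using inj_on_contraD[OF inj that(3,1,2)] .
    moreover have "pairwise (\<lambda>f g. inner_L2 V f g = 0) (?e ` B)" using ob by (simp add: orthogonal_basis_def)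
    ultimately have "inner_L2 V (?e b) (?e b') = 0" using that(1,2) by (simp add: pairwise_def)
    then show ?thesis by (simp only: inner_L2_chi_eq_0_iff)
  qed
  have nV: "card V \<noteq> 0" using assms(2) by simp
  have delta: "(\<Sum>b\<in>B. chi (v - v') b) = (if v = v' then of_nat (card V) else 0)"
    if v: "v \<in> V" "v' \<in> V" for v v'
  proof -
    let ?d = "\<lambda>x. if x = v' then 1 else (0 :: complex)"
    have "?d \<in> L2 V" using v by (auto simp: L2_def)
    then have "?d \<in> cfun.span (?e ` B)" using ob by (simp add: orthogonal_basis_def)
    then obtain c where c: "?d = (\<Sum>f\<in>?e ` B. (\<lambda>x. c f * f x))"
      unfolding cfun.span_finite[OF finite_imageI[OF finite[of B], of ?e]] by blast
    have sum_apply: "(\<Sum>b\<in>B. g b) x = (\<Sum>b\<in>B. g b x)" for g :: "5 ^ 3 \<Rightarrow> 5 ^ 3 \<Rightarrow> complex" and x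
      by (induction B rule: infinite_finite_induct) auto
    define a where "a b = c (?e b)" for b
    have d: "?d x = (\<Sum>b\<in>B. a b * chi b x)" if "x \<in> V" for x
    proof -
      have "?d x = (\<Sum>b\<in>B. (\<lambda>x. c (?e b) * ?e b x)) x"
        using fun_cong[OF c, of x] unfolding sum.reindex[OF inj] o_def .
      also have "\<dots> = (\<Sum>b\<in>B. a b * chi b x)"
        unfolding sum_apply a_def using that by (intro sum.cong refl) (simp add: restr_def)
      finally show ?thesis .
    qed
    \<comment> \<open>The coefficient at \<open>b\<close> is found by pairing with the exponential
      of \<open>b\<close>.\<close>
    have a: "a b * of_nat (card V) = cnj (chi b v')" if b: "b \<in> B" for b
    proof -
      have "cnj (chi b v') = (\<Sum>x\<in>V. ?d x * cnj (chi b x))"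
        using v by (simp add: if_distrib[of "\<lambda>x. x * _"] cong: if_cong)
      also have "\<dots> = (\<Sum>x\<in>V. \<Sum>b'\<in>B. a b' * chi (b' - b) x)"
        by (intro sum.cong refl) (simp only: d sum_distrib_right mult.assoc chi_mult_cnj)
      also have "\<dots> = (\<Sum>b'\<in>B. a b' * (\<Sum>x\<in>V. chi (b' - b) x))"
        by (subst sum.swap) (simp only: sum_distrib_left)
      also have "\<dots> = (\<Sum>b'\<in>B. if b' = b then a b * of_nat (card V) else 0)"
      proof (intro sum.cong refl)
        fix b' assume "b' \<in> B"
        then show "a b' * (\<Sum>x\<in>V. chi (b' - b) x) = (if b' = b then a b * of_nat (card V) else 0)"
          using equidist[of b' b] b sum_chi_eq_0_iff[of "b' - b" V] by auto
      qed
      finally show ?thesis using b by simp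
    qed
    have "(\<Sum>b\<in>B. chi (v - v') b) = (\<Sum>b\<in>B. chi b v * cnj (chi b v'))"
      by (simp only: chi_commute[of _ v] chi_commute[of _ v'] chi_mult_cnj)
    also have "\<dots> = (\<Sum>b\<in>B. a b * chi b v) * of_nat (card V)"
      unfolding sum_distrib_right by (intro sum.cong refl) (simp only: a[symmetric] ac_simps)
    also have "\<dots> = ?d v * of_nat (card V)" by (simp only: d[OF v(1)])
    finally show ?thesis by simp
  qed
  show ?thesis
  proof (rule that)
    obtain v where "v \<in> V" using assms(2) by auto
    then have "of_nat (card B) = (of_nat (card V) :: complex)" using delta[of v v] by simp
    then show "card B = card V" by (simp only: of_nat_eq_iff)
    show "equidist V (b - b')" if "b \<in> B" "b' \<in> B" "b \<noteq> b'" for b b' using that by (rule equidist)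
    show "equidist B (v - v')" if "v \<in> V" "v' \<in> V" "v \<noteq> v'" for v v'
      using delta[of v v'] that by (simp add: sum_chi_eq_0_iff)
  qed
qed

text \<open>Orthogonality makes the exponentials independent; there are \<open>card V\<close> of
  them in a space spanned by the \<open>card V\<close> indicators of points, so they span
  it.\<close>

lemma spectral_if_equidist:
  assumes "V \<noteq> {}" "card B = card V"
    and equidist: "\<And>b b'. b \<in> B \<Longrightarrow> b' \<in> B \<Longrightarrow> b \<noteq> b' \<Longrightarrow> equidist V (b - b')"
  shows "spectral V"
proof -
  let ?e = "\<lambda>b. restr V (chi b)"
  let ?E = "?e ` B"
  have nV: "card V \<noteq> 0" using assms(1) by simp
  have ip: "inner_L2 V (?e b) (?e b') = (if b = b' then of_nat (card V) else 0)" if "b \<in> B" "b' \<in> B" for b b'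
    using equidist[of b b'] that inner_L2_chi_eq_0_iff[of V b b'] by (auto simp: inner_L2_chi)
  have inj: "inj_on ?e B"
  proof (rule inj_onI, rule ccontr)
    fix b b' assume b: "b \<in> B" "b' \<in> B" "?e b = ?e b'" "b \<noteq> b'"
    then have "inner_L2 V (?e b) (?e b) = inner_L2 V (?e b) (?e b')" by simp
    then show False using ip[OF b(1,1)] ip[OF b(1,2)] b(4) nV by (metis of_nat_eq_0_iff)
  qed
  have sum_apply: "(\<Sum>f\<in>A. g f) x = (\<Sum>f\<in>A. g f x)"
    for A :: "'b set" and g :: "'b \<Rightarrow> 5 ^ 3 \<Rightarrow> complex" and x
    by (induction A rule: infinite_finite_induct) auto
  have indep: "cfun.independent ?E"
  proof (rule cfun.independent_if_scalars_zero)
    fix c f assume s: "(\<Sum>f\<in>?E. (\<lambda>x. c f * f x)) = 0" and "f \<in> ?E"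
    then obtain b where b: "b \<in> B" "f = ?e b" by auto
    have "0 = inner_L2 V (\<Sum>f\<in>?E. (\<lambda>x. c f * f x)) (?e b)" unfolding s by (simp add: inner_L2_def)
    also have "\<dots> = (\<Sum>f\<in>?E. c f * inner_L2 V f (?e b))"
      unfolding inner_L2_def sum_apply sum_distrib_right sum_distrib_left
      by (subst sum.swap) (simp only: mult.assoc)
    also have "\<dots> = (\<Sum>b'\<in>B. c (?e b') * inner_L2 V (?e b') (?e b))"
      by (simp add: sum.reindex[OF inj])
    also have "\<dots> = (\<Sum>b'\<in>B. if b' = b then c (?e b) * of_nat (card V) else 0)"
      using b by (intro sum.cong refl) (simp add: ip)
    also have "\<dots> = c (?e b) * of_nat (card V)" using b by simp
    finally show "c f = 0" using nV b by simp
  qed simp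
  let ?D = "(\<lambda>v x. if x = v then 1 else (0 :: complex)) ` V"
  have L2_le: "L2 V \<subseteq> cfun.span ?D"
  proof
    fix f assume f: "f \<in> L2 V"
    have "f = (\<Sum>v\<in>V. (\<lambda>x. f v * (if x = v then 1 else 0)))"
    proof
      fix x
      show "f x = (\<Sum>v\<in>V. (\<lambda>x. f v * (if x = v then 1 else 0))) x"
        using f unfolding sum_apply by (cases "x \<in> V") (simp_all add: L2_def if_distrib cong: if_cong)
    qed
    also have "\<dots> \<in> cfun.span ?D"
      by (intro cfun.span_sum cfun.span_scale cfun.span_base) auto
    finally show "f \<in> cfun.span ?D" .
  qed
  have E_le: "?E \<subseteq> L2 V" by (auto simp: L2_def restr_def)
  have "cfun.span ?E = L2 V"
  proof
    have "cfun.subspace (L2 V)" unfolding cfun.subspace_def by (simp add: L2_def)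
    then show "cfun.span ?E \<subseteq> L2 V" using E_le by (rule cfun.span_minimal[rotated])
    show "L2 V \<subseteq> cfun.span ?E"
    proof (rule ccontr)
      assume "\<not> L2 V \<subseteq> cfun.span ?E"
      then obtain f where f: "f \<in> L2 V" "f \<notin> cfun.span ?E" by auto
      then have "cfun.independent (insert f ?E)" using indep by (intro cfun.independent_insertI)
      moreover have "insert f ?E \<subseteq> cfun.span ?D" using f(1) E_le L2_le by blast
      ultimately have "card (insert f ?E) \<le> card ?D"
        by (rule conjunct2[OF cfun.independent_span_bound[OF finite_imageI[OF finite]]])
      also have "\<dots> \<le> card V" by (rule card_image_le) simp
      finally have "card (insert f ?E) \<le> card V" .
      moreover have "f \<notin> ?E"
      proof
        assume "f \<in> ?E"
        from cfun.span_base[OF this] show False using f(2) by contradiction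
      qed
      then have "card (insert f ?E) = Suc (card ?E)" by (intro card_insert_disjoint) simp_all
      moreover have "card ?E = card V" using card_image[OF inj] assms(2) by (rule trans)
      ultimately show False by linarith
    qed
  qed
  moreover have "pairwise (\<lambda>f g. inner_L2 V f g = 0) ?E"
    unfolding pairwise_def using ip by auto
  ultimately show ?thesis unfolding spectral_def orthogonal_basis_def using inj indep by blast
qed

section \<open>Tilings and the two implications\<close>

lemma card_eq_125_if_all_equidist:
  assumes "B \<noteq> {}" "\<And>d. d \<noteq> 0 \<Longrightarrow> equidist B d"
  shows "card B = 125"
proof -
  obtain x where x: "x \<in> B" using assms(1) by auto
  \<comment> \<open>Count the points on the 31 planes through \<open>x\<close>: \<open>x\<close>
    lies on all, every other point on 6, while equidistribution puts \<open>card B / 5\<close>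
    points on each.\<close>
  have "(\<Sum>d\<in>proj. plane_count B d (x \<odot> d)) = (\<Sum>d\<in>proj. \<Sum>b\<in>B. of_bool (d \<odot> (b - x) = 0))"
    unfolding plane_count_def card_eq_sum_of_bool[OF finite]
    by (intro sum.cong refl) (auto simp: dot_commute)
  also have "\<dots> = (\<Sum>b\<in>B. card {d \<in> proj. d \<odot> (b - x) = 0})"
    by (subst sum.swap) (simp only: card_eq_sum_of_bool[OF finite])
  also have "\<dots> = card {d \<in> proj. d \<odot> (x - x) = 0} + (\<Sum>b\<in>B - {x}. card {d \<in> proj. d \<odot> (b - x) = 0})"
    by (rule sum.remove[OF finite x])
  also have "(\<Sum>b\<in>B - {x}. card {d \<in> proj. d \<odot> (b - x) = 0}) = (\<Sum>b\<in>B - {x}. 6)"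
    by (intro sum.cong refl card_proj_plane) auto
  also have "card {d \<in> proj. d \<odot> (x - x) = 0} = 31" using card_proj by simp
  finally have s: "(\<Sum>d\<in>proj. plane_count B d (x \<odot> d)) = 31 + 6 * (card B - 1)" using x by simp
  have "5 * (\<Sum>d\<in>proj. plane_count B d (x \<odot> d)) = (\<Sum>d\<in>proj. card B)"
    unfolding sum_distrib_left using assms(2) by (intro sum.cong refl) (metis equidist_def zero_notin_proj)
  then have "5 * (31 + 6 * (card B - 1)) = 31 * card B" unfolding s by (simp add: card_proj)
  moreover have "card B \<noteq> 0" using assms(1) by simp
  ultimately show ?thesis by simp
qed

lemma equidist_UNIV: "d \<noteq> 0 \<Longrightarrow> equidist UNIV d"
  by (simp add: equidist_def plane_count_def card_plane)

text \<open>The sum of a nontrivial character over the whole space vanishes, and the tiling factors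
  it into the sums over \<open>V\<close> and \<open>A\<close>.\<close>

lemma tilesE:
  assumes "tiles V"
  obtains A where "card V * card A = 125" "\<And>d. d \<noteq> 0 \<Longrightarrow> equidist V d \<or> equidist A d"
proof -
  obtain A where A: "\<And>x. \<exists>!p. p \<in> V \<times> A \<and> x = fst p + snd p" using assms unfolding tiles_def by blast
  have bij: "bij_betw (\<lambda>p. fst p + snd p) (V \<times> A) UNIV"
    unfolding bij_betw_def inj_on_def using A by (intro conjI ballI impI) (metis, blast)
  have "card V * card A = 125"
    using bij_betw_same_card[OF bij] by (simp add: card_cartesian_product)
  moreover have "equidist V d \<or> equidist A d" if "d \<noteq> 0" for d
  proof -
    have "(\<Sum>v\<in>V. chi d v) * (\<Sum>a\<in>A. chi d a) = (\<Sum>p\<in>V \<times> A. chi d (fst p + snd p))"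
      by (simp add: sum_product chi_add sum.cartesian_product case_prod_beta)
    also have "\<dots> = (\<Sum>x\<in>UNIV. chi d x)" by (rule sum.reindex_bij_betw[OF bij])
    also have "\<dots> = 0" using equidist_UNIV[OF that] by (simp add: sum_chi_eq_0_iff)
    finally show ?thesis using sum_chi_eq_0_iff by auto
  qed
  ultimately show ?thesis by (rule that)
qed

lemma tilesI:
  assumes "card V * card A = 125"
    and "\<And>v v' a a'. v \<in> V \<Longrightarrow> v' \<in> V \<Longrightarrow> a \<in> A \<Longrightarrow> a' \<in> A \<Longrightarrow> v + a = v' + a' \<Longrightarrow> v = v'"
  shows "tiles V"
proof -
  let ?f = "\<lambda>p :: (5 ^ 3) \<times> (5 ^ 3). fst p + snd p"
  have inj: "inj_on ?f (V \<times> A)"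
  proof (rule inj_onI)
    fix p q assume "p \<in> V \<times> A" "q \<in> V \<times> A" "?f p = ?f q"
    then have "fst p = fst q" using assms(2)[of "fst p" "fst q" "snd p" "snd q"] by (simp add: mem_Times_iff)
    then show "p = q" using \<open>?f p = ?f q\<close> by (simp add: prod_eq_iff)
  qed
  have "?f ` (V \<times> A) = UNIV"
    using card_image[OF inj] assms(1) by (intro card_subset_eq) (simp_all add: card_cartesian_product)
  then have "\<exists>!p. p \<in> V \<times> A \<and> x = ?f p" for x
    using inj unfolding inj_on_def by (metis (no_types, lifting) UNIV_I imageE)
  then show ?thesis unfolding tiles_def by blast
qed

lemma divisor_125: "(n :: nat) * m = 125 \<Longrightarrow> n = 1 \<and> m = 125 \<or> n = 5 \<and> m = 25 \<or> n = 25 \<and> m = 5 \<or> n = 125 \<and> m = 1"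
proof -
  assume nm: "n * m = 125"
  have p: "prime (5 :: nat)" by simp
  have "n dvd 5 ^ 3" using nm by (intro dvdI[of _ _ m]) simp
  then obtain i where "i \<le> 3" "n = 5 ^ i" using divides_primepow_nat[OF p] by blast
  then have "n = 1 \<or> n = 5 \<or> n = 25 \<or> n = 125" by (auto simp: le_Suc_eq numeral_eq_Suc)
  then show ?thesis using nm by auto
qed

lemma tiles_imp_spectral:
  assumes "tiles V" "V \<noteq> {}" shows "spectral V"
proof -
  obtain A where A: "card V * card A = 125" "\<And>d. d \<noteq> 0 \<Longrightarrow> equidist V d \<or> equidist A d"
    using tilesE[OF assms(1)] by metis
  consider "card V = 1" | "card V = 5" "card A = 25" | "card V = 25" "card A = 5" | "card V = 125"
    using divisor_125[OF A(1)] by blast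
  then show ?thesis
  proof cases
    case 1
    then show ?thesis using assms by (intro spectral_if_equidist[of V "{0}"]) auto
  next
    case 2
    have "A \<noteq> {}" using 2 by auto
    then obtain d where d: "d \<noteq> 0" "\<not> equidist A d" using card_eq_125_if_all_equidist[of A] 2 by auto
    then have "equidist V d" using A(2) by blast
    show ?thesis
    proof (rule spectral_if_equidist[OF assms(2)])
      show "card (range (\<lambda>c. c *s d)) = card V" using card_line[OF d(1)] 2 by simp
      fix b b' assume "b \<in> range (\<lambda>c. c *s d)" "b' \<in> range (\<lambda>c. c *s d)" "b \<noteq> b'"
      then obtain c c' where b: "b = c *s d" "b' = c' *s d" "c - c' \<noteq> 0" by auto
      then have "b - b' = (c - c') *s d" by (simp only: vector_sub_rdistrib)
      then show "equidist V (b - b')" using equidist_scale[OF b(3)] \<open>equidist V d\<close> by simp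
    qed
  next
    case 3
    then have "\<not> card A \<le> Suc 0" by simp
    then obtain a a' where a: "a \<in> A" "a' \<in> A" "a \<noteq> a'" by (auto simp: card_le_Suc0_iff_eq)
    show ?thesis
    proof (rule spectral_if_equidist[OF assms(2)])
      show "card {x. x \<odot> (a - a') = 0} = card V" using card_plane[of "a - a'" 0] a 3 by simp
      fix b b' assume "b \<in> {x. x \<odot> (a - a') = 0}" "b' \<in> {x. x \<odot> (a - a') = 0}" "b \<noteq> b'"
      then have b: "b - b' \<noteq> 0" "(b - b') \<odot> (a - a') = 0" by auto
      \<comment> \<open>This plane contains both \<open>a\<close> and \<open>a'\<close>, whereas
        equidistribution of the five points of \<open>A\<close> allows only one.\<close>
      have "card {a, a'} \<le> plane_count A (b - b') (a \<odot> (b - b'))"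
        unfolding plane_count_def using a b(2) by (intro card_mono) (auto simp: dot_commute algebra_simps)
      then have "5 * plane_count A (b - b') (a \<odot> (b - b')) \<noteq> card A" using a(3) 3(2) by simp
      then have "\<not> equidist A (b - b')" unfolding equidist_def by blast
      then show "equidist V (b - b')" using A(2) b(1) by blast
    qed
  next
    case 4
    then have "V = UNIV" by (intro card_subset_eq) auto
    then show ?thesis using equidist_UNIV by (intro spectral_if_equidist[of V UNIV]) auto
  qed
qed

lemma spectral_imp_tiles:
  assumes "spectral V" "V \<noteq> {}" shows "tiles V"
proof -
  obtain B where B: "card B = card V"
    and equidist_V: "\<And>b b'. b \<in> B \<Longrightarrow> b' \<in> B \<Longrightarrow> b \<noteq> b' \<Longrightarrow> equidist V (b - b')"
    and equidist_B: "\<And>v v'. v \<in> V \<Longrightarrow> v' \<in> V \<Longrightarrow> v \<noteq> v' \<Longrightarrow> equidist B (v - v')"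
    using spectral_equidist[OF assms] by metis
  have ne: "card V \<noteq> 0" "B \<noteq> {}" using assms(2) B by auto
  show ?thesis
  proof (cases "card V = 1")
    case True
    then obtain v where "V = {v}" by (auto simp: card_1_singleton_iff)
    then show ?thesis by (intro tilesI[of V UNIV]) auto
  next
    case False
    \<comment> \<open>Two elements of \<open>B\<close> provide an even direction of
      \<open>V\<close>, so 5 divides \<open>card V\<close>.\<close>
    then have "\<not> card B \<le> Suc 0" using B ne(1) False by linarith
    then obtain b b' where b: "b \<in> B" "b' \<in> B" "b \<noteq> b'" by (auto simp: card_le_Suc0_iff_eq)
    define d where "d = b - b'"
    have d: "d \<noteq> 0" "equidist V d" using b equidist_V by (auto simp: d_def)
    define k where "k = plane_count V d 0"
    have k: "card V = 5 * k" using d(2) by (simp add: equidist_def k_def)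
    consider "k = 1" | "1 < k" "k < 5" | "k = 5" | "5 < k" using k ne(1) by fastforce
    then show ?thesis
    proof cases
      case 1
      show ?thesis
      proof (rule tilesI)
        show "card V * card {x. x \<odot> d = 0} = 125" using card_plane[OF d(1), of 0] k 1 by simp
        fix v v' a a'
        assume v: "v \<in> V" "v' \<in> V" "a \<in> {x. x \<odot> d = 0}" "a' \<in> {x. x \<odot> d = 0}" "v + a = v' + a'"
        have "(v + a) \<odot> d = (v' + a') \<odot> d" using v(5) by simp
        then have vd: "v \<odot> d = v' \<odot> d" using v(3,4) by simp
        \<comment> \<open>For \<open>k = 1\<close> every plane orthogonal to \<open>d\<close>
          contains exactly one point of \<open>V\<close>.\<close>
        have "card {x \<in> V. x \<odot> d = v' \<odot> d} = 1" using d(2) k 1 by (simp add: equidist_def plane_count_def)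
        then obtain z where z: "{x \<in> V. x \<odot> d = v' \<odot> d} = {z}" by (auto simp: card_1_singleton_iff)
        have "v \<in> {x \<in> V. x \<odot> d = v' \<odot> d}" "v' \<in> {x \<in> V. x \<odot> d = v' \<odot> d}"
          using v(1,2) vd by simp_all
        then show "v = v'" unfolding z by simp
      qed
    next
      case 2
      then show ?thesis using spectral_pair_False[of V k B] k B equidist_V equidist_B by auto
    next
      case 3
      \<comment> \<open>As \<open>B\<close> has 25 points it has an uneven direction, which no
        difference of points of \<open>V\<close> can have.\<close>
      then obtain d where d: "d \<noteq> 0" "\<not> equidist B d" using card_eq_125_if_all_equidist[OF ne(2)] k B by auto
      show ?thesis
      proof (rule tilesI)
        show "card V * card (range (\<lambda>c. c *s d)) = 125" using card_line[OF d(1)] k 3 by simp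
        fix v v' a a'
        assume v: "v \<in> V" "v' \<in> V" "a \<in> range (\<lambda>c. c *s d)" "a' \<in> range (\<lambda>c. c *s d)" "v + a = v' + a'"
        obtain c c' where "a = c *s d" "a' = c' *s d" using v(3,4) by auto
        then have e: "v - v' = (c' - c) *s d" using v(5) by (simp add: vector_sub_rdistrib algebra_simps)
        show "v = v'"
        proof (rule ccontr)
          assume "v \<noteq> v'"
          then have "equidist B ((c' - c) *s d)" "c' - c \<noteq> 0" using equidist_B[OF v(1,2)] e by auto
          then show False using d(2) equidist_scale by blast
        qed
      qed
    next
      case 4
      have "equidist B d" if d: "d \<noteq> 0" for d
      proof -
        obtain u where u: "u \<noteq> 0" "u \<odot> d = 0" using exists_orthogonal[OF d] .
        obtain w where w: "w \<odot> d = 0" "cross u w \<noteq> 0" using orthogonal_basis_exists[OF d u] .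
        \<comment> \<open>More than 25 points cannot lie on distinct lines parallel to
          \<open>d\<close>, of which there are 25.\<close>
        have "\<not> inj_on (\<lambda>v. (v \<odot> u, v \<odot> w)) V"
        proof
          assume "inj_on (\<lambda>v. (v \<odot> u, v \<odot> w)) V"
          then have "card V \<le> card (UNIV :: (5 \<times> 5) set)" by (rule card_inj_on_le) simp_all
          then show False using 4 k by simp
        qed
        then obtain v v' where v: "v \<in> V" "v' \<in> V" "v \<noteq> v'" "(v - v') \<odot> u = 0" "(v - v') \<odot> w = 0"
          by (auto simp: inj_on_def)
        obtain c where c: "v - v' = c *s cross u w" using orthogonal_both[OF v(4,5) w(2)] .
        obtain c' where c': "d = c' *s cross u w"
          using orthogonal_both[of d u w] u w by (metis dot_commute)
        have "c \<noteq> 0" "c' \<noteq> 0" using c c' v(3) d by auto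
        then show "equidist B d" using equidist_B[OF v(1-3)] equidist_scale c c' by metis
      qed
      then have "card V = 125" using card_eq_125_if_all_equidist[OF ne(2)] B by simp
      then show ?thesis by (intro tilesI[of V "{0}"]) auto
    qed
  qed
qed

theorem theorem1p1:
  fixes V :: "(5 ^ 3) set"
  assumes "V \<noteq> {}"
  shows "tiles V \<longleftrightarrow> spectral V"
  using assms tiles_imp_spectral spectral_imp_tiles by blast

end
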